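(* All asymptotic relations below hold almost surely. (i) If $a$ is known, then the statistic $$\widehat H_k(a)=\frac{k+2\log_2a-\log_2V_{2^k}^{H,2}}{2(k-\log_2T)}$$ is a strongly consistent estimator of $H\in(0,1/2)$ (i.e. converges to $H$ almost surely as $k\to\infty$); moreover, for any $\varepsilon>0$, $$\widehat H_k(a)=H+O(2^{k(2H-1)})+o(2^{k(-1/2+\varepsilon)}),\quad k\to\infty.$$ (ii) If $b$ is known, then the statistic $$\widetilde H_k(b)=\frac12\left(\log_{2+}\frac{V_{2^k}^{H,2}-b^2T}{V_{2^{k+1}}^{H,2}-b^2T}+1\right)$$ is a consistent estimator of $H\in(0,3/4)$; moreover, for any $\varepsilon>0$, $$\widetilde H_k(b)=H+o(2^{k(-1/2+\varepsilon)})+o(2^{k(2H-3/2+\varepsilon)}),\quad k\to\infty.$$ (iii) If $a$ and $b$ are known, then the statistic $$\widehat H_k(a,b)=\frac{k+2\log_2a-\log_{2+}\left(V_{2^k}^{H,2}-b^2T\right)}{2(k-\log_2T)}$$ is a strongly consistent estimator of $H\in(0,3/4)$; moreover, for any $\varepsilon>0$, $$\widehat H_k(a,b)=H+o(2^{k(-1/2+\varepsilon)})+o(2^{k(2H-3/2+\varepsilon)}),\quad k\to\infty.$$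
   Context: Mixed model: $M_t^H=aB_t^H+bW_t$, $t\in[0,T]$, where $T>0$, $a>0$, $b>0$, $W$ is a standard Wiener process and $B^H$ is a fractional Brownian motion with Hurst parameter $H$ (centered Gaussian, $\mathsf{E}[B^H_tB^H_s]=\frac12(t^{2H}+s^{2H}-|t-s|^{2H})$), independent of $W$. For $n\ge1$, $\Delta_i^nX=X_{T(i+1)/n}-X_{Ti/n}$, $i=0,\dots,n-1$; $V_n^{H,2}=\sum_{i=0}^{n-1}(\Delta_i^nM^H)^2$; $\log_{2+}x=\log_2x$ for $x>0$ and $\log_{2+}x=0$ for $x\le0$. The statistics are considered for $k>\log_2T$. *)

theory Defs
  imports "HOL-Probability.Probability" "HOL-Library.Landau_Symbols"
begin

(* Degenerate (constant) laws count as Gaussian. *)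
definition gaussian_rv :: "'a measure \<Rightarrow> ('a \<Rightarrow> real) \<Rightarrow> bool" where
  "gaussian_rv M X \<longleftrightarrow> X \<in> borel_measurable M \<and>
     ((\<exists>\<mu>. AE \<omega> in M. X \<omega> = \<mu>) \<or>
      (\<exists>\<mu> \<sigma>. \<sigma> > 0 \<and> distributed M lborel X (\<lambda>x. ennreal (normal_density \<mu> \<sigma> x))))"

definition gaussian_process :: "'a measure \<Rightarrow> real set \<Rightarrow> (real \<Rightarrow> 'a \<Rightarrow> real) \<Rightarrow> bool" where
  "gaussian_process M S X \<longleftrightarrow>
     (\<forall>F c. finite F \<and> F \<subseteq> S \<longrightarrow> gaussian_rv M (\<lambda>\<omega>. \<Sum>t\<in>F. c t * X t \<omega>))"

definition fractional_brownian_motion ::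
    "'a measure \<Rightarrow> real set \<Rightarrow> real \<Rightarrow> (real \<Rightarrow> 'a \<Rightarrow> real) \<Rightarrow> bool" where
  "fractional_brownian_motion M S H B \<longleftrightarrow>
     gaussian_process M S B \<and>
     (\<forall>t\<in>S. integral\<^sup>L M (B t) = 0) \<and>
     (\<forall>t\<in>S. \<forall>s\<in>S. integral\<^sup>L M (\<lambda>\<omega>. B t \<omega> * B s \<omega>) =
        (t powr (2 * H) + s powr (2 * H) - \<bar>t - s\<bar> powr (2 * H)) / 2)"

(* The time set S is meant to contain 0. *)
definition wiener_process ::
    "'a measure \<Rightarrow> real set \<Rightarrow> (real \<Rightarrow> 'a \<Rightarrow> real) \<Rightarrow> bool" where
  "wiener_process M S W \<longleftrightarrow>
     (\<forall>t\<in>S. W t \<in> borel_measurable M) \<and>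
     (AE \<omega> in M. W 0 \<omega> = 0) \<and>
     (\<forall>n t. strict_mono_on {..n} t \<and> t ` {..n} \<subseteq> S \<longrightarrow>
        prob_space.indep_vars M (\<lambda>_. borel)
          (\<lambda>i \<omega>. W (t (Suc i)) \<omega> - W (t i) \<omega>) {..<n::nat}) \<and>
     (\<forall>s\<in>S. \<forall>t\<in>S. s < t \<longrightarrow>
        distributed M lborel (\<lambda>\<omega>. W t \<omega> - W s \<omega>)
          (\<lambda>x. ennreal (normal_density 0 (sqrt (t - s)) x))) \<and>
     (AE \<omega> in M. continuous_on S (\<lambda>t. W t \<omega>))"

(* Independence of the two processes as random elements of the product space R^S. *)
definition indep_processes ::
    "'a measure \<Rightarrow> real set \<Rightarrow> (real \<Rightarrow> 'a \<Rightarrow> real) \<Rightarrow> (real \<Rightarrow> 'a \<Rightarrow> real) \<Rightarrow> bool" where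
  "indep_processes M S X Y \<longleftrightarrow>
     prob_space.indep_var M
       (PiM S (\<lambda>_. borel)) (\<lambda>\<omega>. \<lambda>t\<in>S. X t \<omega>)
       (PiM S (\<lambda>_. borel)) (\<lambda>\<omega>. \<lambda>t\<in>S. Y t \<omega>)"

definition mixed_process ::
    "real \<Rightarrow> real \<Rightarrow> (real \<Rightarrow> 'a \<Rightarrow> real) \<Rightarrow> (real \<Rightarrow> 'a \<Rightarrow> real) \<Rightarrow> real \<Rightarrow> 'a \<Rightarrow> real" where
  "mixed_process a b B W t \<omega> = a * B t \<omega> + b * W t \<omega>"

definition increment :: "real \<Rightarrow> nat \<Rightarrow> (real \<Rightarrow> 'a \<Rightarrow> real) \<Rightarrow> nat \<Rightarrow> 'a \<Rightarrow> real" where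
  "increment T n X i \<omega> = X (T * real (i + 1) / real n) \<omega> - X (T * real i / real n) \<omega>"

definition quadratic_variation :: "real \<Rightarrow> (real \<Rightarrow> 'a \<Rightarrow> real) \<Rightarrow> nat \<Rightarrow> 'a \<Rightarrow> real" where
  "quadratic_variation T X n \<omega> = (\<Sum>i<n. (increment T n X i \<omega>)\<^sup>2)"

definition log2_plus :: "real \<Rightarrow> real" where
  "log2_plus x = (if x > 0 then log 2 x else 0)"

(* The statistics are functions of the observed path X and of the parameters assumed
   known only. A vanishing denominator in hurst_est_b (an event of probability 0 under
   the mixed model) yields log2_plus 0 = 0 by the convention x / 0 = 0. *)
definition hurst_est_a ::
    "real \<Rightarrow> real \<Rightarrow> (real \<Rightarrow> 'a \<Rightarrow> real) \<Rightarrow> nat \<Rightarrow> 'a \<Rightarrow> real" where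
  "hurst_est_a T a X k \<omega> =
     (real k + 2 * log 2 a - log 2 (quadratic_variation T X (2 ^ k) \<omega>)) /
     (2 * (real k - log 2 T))"

definition hurst_est_b ::
    "real \<Rightarrow> real \<Rightarrow> (real \<Rightarrow> 'a \<Rightarrow> real) \<Rightarrow> nat \<Rightarrow> 'a \<Rightarrow> real" where
  "hurst_est_b T b X k \<omega> =
     1 / 2 * (log2_plus ((quadratic_variation T X (2 ^ k) \<omega> - b\<^sup>2 * T) /
                         (quadratic_variation T X (2 ^ (k + 1)) \<omega> - b\<^sup>2 * T)) + 1)"

definition hurst_est_ab ::
    "real \<Rightarrow> real \<Rightarrow> real \<Rightarrow> (real \<Rightarrow> 'a \<Rightarrow> real) \<Rightarrow> nat \<Rightarrow> 'a \<Rightarrow> real" where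
  "hurst_est_ab T a b X k \<omega> =
     (real k + 2 * log 2 a - log2_plus (quadratic_variation T X (2 ^ k) \<omega> - b\<^sup>2 * T)) /
     (2 * (real k - log 2 T))"

(* Both notions require the estimators to be random variables; in particular the events
   in the second one are measurable. *)
definition strongly_consistent :: "'a measure \<Rightarrow> (nat \<Rightarrow> 'a \<Rightarrow> real) \<Rightarrow> real \<Rightarrow> bool" where
  "strongly_consistent M est \<theta> \<longleftrightarrow>
     (\<forall>k. est k \<in> borel_measurable M) \<and>
     (AE \<omega> in M. (\<lambda>k. est k \<omega>) \<longlonglongrightarrow> \<theta>)"

definition consistent :: "'a measure \<Rightarrow> (nat \<Rightarrow> 'a \<Rightarrow> real) \<Rightarrow> real \<Rightarrow> bool" where
  "consistent M est \<theta> \<longleftrightarrow>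
     (\<forall>k. est k \<in> borel_measurable M) \<and>
     (\<forall>\<delta>>0. (\<lambda>k. measure M {\<omega> \<in> space M. \<bar>est k \<omega> - \<theta>\<bar> > \<delta>}) \<longlonglongrightarrow> 0)"

end

theory Submission
  imports Defs "HOL-Real_Asymp.Real_Asymp"
begin

text \<open>
  With \<open>n = 2\<^sup>k\<close>, the quadratic variation \<open>V\<close> of the mixed process satisfies
  \<open>V - b\<^sup>2 T = A (1 + e)\<close>, where \<open>A = a\<^sup>2 T\<^bsup>2H\<^esup> n\<^bsup>1-2H\<^esup>\<close> and \<open>e\<close> has mean zero. By Isserlis' formula
  the variance of \<open>V\<close> is twice the sum of the squared covariances of the increments; these are those
  of fractional Gaussian noise plus a diagonal Wiener term, and the former are square summable exactly
  when \<open>H < 3/4\<close>. Hence the second moment of \<open>e\<close> is of order \<open>n\<^bsup>-1\<^esup> + n\<^bsup>4H-3\<^esup>\<close>, and since the sample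
  sizes grow geometrically, the second moments of \<open>e\<close> divided by
  \<open>n\<^bsup>-1/2+\<epsilon>\<^esup> + n\<^bsup>2H-3/2+\<epsilon>\<^esup>\<close> are summable, so that this quotient tends to 0 almost surely. Taking
  logarithms gives the expansions; in the estimator that does not subtract \<open>b\<^sup>2 T\<close> this term
  contributes the bias of order \<open>n\<^bsup>2H-1\<^esup>\<close>.
\<close>

section \<open>Random variables with the fourth moment of a centred Gaussian\<close>

text \<open>This property is stable under independent sums, so no Gaussian law has to be derived for the
  mixed process.\<close>

context prob_space
begin

text \<open>Pointwise \<open>\<bar>x\<bar> ^ p\<close> is at most 1 or at most
  \<open>\<bar>x\<bar> ^ 4\<close>, and constants are integrable for a probability measure.\<close>

lemma integrable_power_le:
  fixes X :: "'a \<Rightarrow> real"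
  assumes X: "random_variable borel X" and int: "integrable M (\<lambda>\<omega>. X \<omega> ^ 4)" and "p \<le> 4"
  shows "integrable M (\<lambda>\<omega>. X \<omega> ^ p)"
proof (rule Bochner_Integration.integrable_bound)
  show "integrable M (\<lambda>\<omega>. 1 + X \<omega> ^ 4)"
    using int by simp
  have "\<bar>x\<bar> ^ p \<le> 1 + \<bar>x\<bar> ^ 4" for x :: real
  proof (cases "\<bar>x\<bar> \<le> 1")
    case True
    then have "\<bar>x\<bar> ^ p \<le> 1" by (simp add: power_le_one)
    also have "\<dots> \<le> 1 + \<bar>x\<bar> ^ 4" by simp
    finally show ?thesis .
  next
    case False
    then have "\<bar>x\<bar> ^ p \<le> \<bar>x\<bar> ^ 4" using \<open>p \<le> 4\<close> by (intro power_increasing) auto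
    then show ?thesis by simp
  qed
  then show "AE \<omega> in M. norm (X \<omega> ^ p) \<le> norm (1 + X \<omega> ^ 4)"
    by (simp add: power_abs)
qed (use X in measurable)

definition normal_kurtosis :: "('a \<Rightarrow> real) \<Rightarrow> bool" where
  "normal_kurtosis X \<longleftrightarrow> random_variable borel X \<and> integrable M (\<lambda>\<omega>. X \<omega> ^ 4) \<and>
     expectation X = 0 \<and> expectation (\<lambda>\<omega>. X \<omega> ^ 4) = 3 * (expectation (\<lambda>\<omega>. (X \<omega>)\<^sup>2))\<^sup>2"

lemma normal_kurtosis_measurable: "normal_kurtosis X \<Longrightarrow> random_variable borel X"
  by (simp add: normal_kurtosis_def)

lemma normal_kurtosis_integrable:
  assumes "normal_kurtosis X"
  shows "integrable M X" "integrable M (\<lambda>\<omega>. (X \<omega>)\<^sup>2)" "integrable M (\<lambda>\<omega>. X \<omega> ^ 3)"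
    "integrable M (\<lambda>\<omega>. X \<omega> ^ 4)"
  using assms integrable_power_le[of X 1] integrable_power_le[of X 2] integrable_power_le[of X 3]
  by (auto simp: normal_kurtosis_def)

lemma normal_kurtosis_scale:
  assumes "normal_kurtosis X"
  shows "normal_kurtosis (\<lambda>\<omega>. c * X \<omega>)"
  using assms by (auto simp: normal_kurtosis_def power_mult_distrib)

text \<open>In the binomial expansion the terms with a factor of exponent 1 vanish because the means
  are 0. The middle term 6 E X^2 E Y^2 completes 3 (E X^2)^2 + 3 (E Y^2)^2 to 3 (E X^2 + E
  Y^2)^2.\<close>

lemma normal_kurtosis_add_indep:
  assumes ind: "indep_var borel X borel Y" and X: "normal_kurtosis X" and Y: "normal_kurtosis Y"
  shows "normal_kurtosis (\<lambda>\<omega>. X \<omega> + Y \<omega>)"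
proof -
  note [measurable] = X[THEN normal_kurtosis_measurable] Y[THEN normal_kurtosis_measurable]
  note iX = normal_kurtosis_integrable[OF X] and iY = normal_kurtosis_integrable[OF Y]
  have pw: "indep_var borel (\<lambda>\<omega>. X \<omega> ^ p) borel (\<lambda>\<omega>. Y \<omega> ^ q)" for p q
    using indep_var_compose[OF ind, of "\<lambda>x. x ^ p" borel "\<lambda>x. x ^ q" borel] by (simp add: comp_def)
  have int: "integrable M (\<lambda>\<omega>. X \<omega> ^ p * Y \<omega> ^ q)"
    and mul: "expectation (\<lambda>\<omega>. X \<omega> ^ p * Y \<omega> ^ q) = expectation (\<lambda>\<omega>. X \<omega> ^ p) * expectation (\<lambda>\<omega>. Y \<omega> ^ q)"
    if "p \<le> 4" "q \<le> 4" for p q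
    using that X Y
    by (auto intro!: indep_var_integrable[OF pw] indep_var_lebesgue_integral[OF pw] integrable_power_le
        simp: normal_kurtosis_def)
  have EX: "expectation X = 0" and EY: "expectation Y = 0"
    using X Y by (auto simp: normal_kurtosis_def)
  \<comment> \<open>The exponents 1 stay explicit here and in \<open>e4\<close>, so that the mixed
    terms are literal instances of \<open>int\<close> and \<open>mul\<close>.\<close>
  have e2: "(X \<omega> + Y \<omega>)\<^sup>2 = (X \<omega>)\<^sup>2 + 2 * (X \<omega> ^ 1 * Y \<omega> ^ 1) + (Y \<omega>)\<^sup>2" for \<omega>
    by (simp add: power2_eq_square algebra_simps)
  have e4: "(X \<omega> + Y \<omega>) ^ 4 = X \<omega> ^ 4 + 4 * (X \<omega> ^ 3 * Y \<omega> ^ 1) + 6 * (X \<omega> ^ 2 * Y \<omega> ^ 2)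
      + 4 * (X \<omega> ^ 1 * Y \<omega> ^ 3) + Y \<omega> ^ 4" for \<omega>
    by (simp add: eval_nat_numeral algebra_simps)
  have E2: "expectation (\<lambda>\<omega>. (X \<omega> + Y \<omega>)\<^sup>2) = expectation (\<lambda>\<omega>. (X \<omega>)\<^sup>2) + expectation (\<lambda>\<omega>. (Y \<omega>)\<^sup>2)"
    unfolding e2 using iX iY int[of 1 1] mul[of 1 1] EX EY by simp
  have E4: "expectation (\<lambda>\<omega>. (X \<omega> + Y \<omega>) ^ 4) = expectation (\<lambda>\<omega>. X \<omega> ^ 4) +
      6 * (expectation (\<lambda>\<omega>. (X \<omega>)\<^sup>2) * expectation (\<lambda>\<omega>. (Y \<omega>)\<^sup>2)) + expectation (\<lambda>\<omega>. Y \<omega> ^ 4)"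
    unfolding e4
    using iX iY int[of 3 1] mul[of 3 1] int[of 1 3] mul[of 1 3] int[of 2 2] mul[of 2 2] EX EY by simp
  have I4: "integrable M (\<lambda>\<omega>. (X \<omega> + Y \<omega>) ^ 4)"
    unfolding e4 using iX iY int[of 3 1] int[of 1 3] int[of 2 2] by auto
  show ?thesis
    unfolding normal_kurtosis_def E4 E2
    using I4 X Y iX iY EX EY
    by (simp add: normal_kurtosis_def) (simp add: power2_eq_square algebra_simps)
qed

lemma normal_kurtosis_AE_zero:
  assumes X[measurable]: "random_variable borel X" and "AE \<omega> in M. X \<omega> = 0"
  shows "normal_kurtosis X"
proof -
  have *: "integrable M (\<lambda>\<omega>. X \<omega> ^ p) \<and> expectation (\<lambda>\<omega>. X \<omega> ^ p) = 0" if "p > 0" for p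
  proof -
    have ae: "AE \<omega> in M. X \<omega> ^ p = 0"
      using assms(2) by eventually_elim (use that in auto)
    have "integrable M (\<lambda>\<omega>. X \<omega> ^ p) \<longleftrightarrow> integrable M (\<lambda>_. 0 :: real)"
      by (rule integrable_cong_AE) (use ae in auto)
    moreover have "expectation (\<lambda>\<omega>. X \<omega> ^ p) = expectation (\<lambda>_. 0)"
      by (rule integral_cong_AE) (use ae in auto)
    ultimately show ?thesis by simp
  qed
  show ?thesis
    using *[of 1] *[of 2] *[of 4] by (simp add: normal_kurtosis_def)
qed

lemma normal_kurtosis_normal:
  assumes D: "distributed M lborel X (\<lambda>x. ennreal (normal_density 0 \<sigma> x))" and \<sigma>: "\<sigma> > 0"
  shows "normal_kurtosis X"
proof -
  have X: "random_variable borel X"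
    using distributed_measurable[OF D] by simp
  \<comment> \<open>The factor 3 is 4! / (2^2 2!), from the formula for even central
    moments.\<close>
  have "has_bochner_integral lborel (\<lambda>x. normal_density 0 \<sigma> x * x ^ 4) (3 * \<sigma> ^ 4)"
    using normal_moment_even[OF \<sigma>, of 0 2] \<sigma> by (simp add: fact_numeral field_simps)
  moreover have "has_bochner_integral lborel (\<lambda>x. normal_density 0 \<sigma> x * x ^ 2) (\<sigma>\<^sup>2)"
    using normal_moment_even[OF \<sigma>, of 0 1] by simp
  moreover have "has_bochner_integral lborel (\<lambda>x. normal_density 0 \<sigma> x * x) 0"
    using normal_moment_odd[OF \<sigma>, of 0 0] by simp
  moreover have "expectation (\<lambda>\<omega>. X \<omega> ^ p) = (\<integral>x. normal_density 0 \<sigma> x * x ^ p \<partial>lborel)" for p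
    by (rule distributed_integral[OF D, symmetric]) auto
  moreover have "integrable M (\<lambda>\<omega>. X \<omega> ^ 4) \<longleftrightarrow> integrable lborel (\<lambda>x. normal_density 0 \<sigma> x * x ^ 4)"
    by (rule distributed_integrable[OF D, symmetric]) auto
  moreover have "expectation X = (\<integral>x. normal_density 0 \<sigma> x * x \<partial>lborel)"
    by (rule distributed_integral[OF D, symmetric]) auto
  ultimately show ?thesis
    using X by (simp add: normal_kurtosis_def has_bochner_integral_iff flip: power_mult)
qed

lemma normal_kurtosis_gaussian:
  assumes G: "gaussian_rv M X" and E: "expectation X = 0"
  shows "normal_kurtosis X"
proof -
  have [measurable]: "random_variable borel X" using G by (simp add: gaussian_rv_def)
  from G consider \<mu> where "AE \<omega> in M. X \<omega> = \<mu>"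
    | \<mu> \<sigma> where "\<sigma> > 0" "distributed M lborel X (\<lambda>x. ennreal (normal_density \<mu> \<sigma> x))"
    by (auto simp: gaussian_rv_def)
  then show ?thesis
  proof cases
    case 1
    then have "expectation X = expectation (\<lambda>_. \<mu>)"
      by (intro integral_cong_AE) auto
    with E have "\<mu> = 0" by (simp add: prob_space)
    with 1 show ?thesis by (intro normal_kurtosis_AE_zero) auto
  next
    case 2
    then have "\<mu> = 0" using normal_distributed_expectation[of \<sigma> X \<mu>] E by simp
    with 2 show ?thesis by (intro normal_kurtosis_normal[of X \<sigma>]) auto
  qed
qed

lemma integrable_gaussian_rv:
  assumes G: "gaussian_rv M X"
  shows "integrable M X"
proof -
  have [measurable]: "random_variable borel X" using G by (simp add: gaussian_rv_def)
  from G consider \<mu> where "AE \<omega> in M. X \<omega> = \<mu>"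
    | \<mu> \<sigma> where "\<sigma> > 0" "distributed M lborel X (\<lambda>x. ennreal (normal_density \<mu> \<sigma> x))"
    by (auto simp: gaussian_rv_def)
  then show ?thesis
  proof cases
    case 1
    then have "integrable M X \<longleftrightarrow> integrable M (\<lambda>_. \<mu>)"
      by (intro integrable_cong_AE) auto
    then show ?thesis by simp
  next
    case 2
    then show ?thesis
      using distributed_integrable[OF 2(2), of "\<lambda>x. x"] integrable_normal_moment_nz_1[of \<sigma> \<mu>] by simp
  qed
qed

lemma integrable_mult_square_integrable:
  fixes X Y :: "'a \<Rightarrow> real"
  assumes [measurable]: "random_variable borel X" "random_variable borel Y"
    and int: "integrable M (\<lambda>\<omega>. (X \<omega>)\<^sup>2)" "integrable M (\<lambda>\<omega>. (Y \<omega>)\<^sup>2)"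
  shows "integrable M (\<lambda>\<omega>. X \<omega> * Y \<omega>)"
proof (rule Bochner_Integration.integrable_bound)
  show "integrable M (\<lambda>\<omega>. (X \<omega>)\<^sup>2 + (Y \<omega>)\<^sup>2)"
    using int by simp
  have "\<bar>x * y\<bar> \<le> x\<^sup>2 + y\<^sup>2" for x y :: real
  proof -
    have "2 * \<bar>x * y\<bar> \<le> x\<^sup>2 + y\<^sup>2"
      using zero_le_power2[of "\<bar>x\<bar> - \<bar>y\<bar>"] by (simp add: power2_diff abs_mult)
    then show ?thesis using zero_le_power2[of x] zero_le_power2[of y] by linarith
  qed
  then show "AE \<omega> in M. norm (X \<omega> * Y \<omega>) \<le> norm ((X \<omega>)\<^sup>2 + (Y \<omega>)\<^sup>2)"
    by simp
qed measurable

text \<open>Isserlis' formula, by polarization of the fourth moment.\<close>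

lemma expectation_square_mult_square:
  assumes K: "\<And>p q. normal_kurtosis (\<lambda>\<omega>. p * X \<omega> + q * Y \<omega>)"
  shows "expectation (\<lambda>\<omega>. (X \<omega>)\<^sup>2 * (Y \<omega>)\<^sup>2) =
    expectation (\<lambda>\<omega>. (X \<omega>)\<^sup>2) * expectation (\<lambda>\<omega>. (Y \<omega>)\<^sup>2) + 2 * (expectation (\<lambda>\<omega>. X \<omega> * Y \<omega>))\<^sup>2"
    and "integrable M (\<lambda>\<omega>. (X \<omega>)\<^sup>2 * (Y \<omega>)\<^sup>2)"
proof -
  have X: "normal_kurtosis X" and Y: "normal_kurtosis Y"
    and P: "normal_kurtosis (\<lambda>\<omega>. X \<omega> + Y \<omega>)" and D: "normal_kurtosis (\<lambda>\<omega>. X \<omega> - Y \<omega>)"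
    using K[of 1 0] K[of 0 1] K[of 1 1] K[of 1 "-1"] by auto
  note [measurable] = X[THEN normal_kurtosis_measurable] Y[THEN normal_kurtosis_measurable]
  note iX = normal_kurtosis_integrable[OF X] and iY = normal_kurtosis_integrable[OF Y]
  note iP = normal_kurtosis_integrable[OF P] and iD = normal_kurtosis_integrable[OF D]
  have XY: "integrable M (\<lambda>\<omega>. X \<omega> * Y \<omega>)"
    using iX iY by (intro integrable_mult_square_integrable) auto
  have e4: "(X \<omega>)\<^sup>2 * (Y \<omega>)\<^sup>2 = ((X \<omega> + Y \<omega>) ^ 4 + (X \<omega> - Y \<omega>) ^ 4 - 2 * X \<omega> ^ 4 - 2 * Y \<omega> ^ 4) / 12" for \<omega>
    by (simp add: eval_nat_numeral algebra_simps)
  show "integrable M (\<lambda>\<omega>. (X \<omega>)\<^sup>2 * (Y \<omega>)\<^sup>2)"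
    unfolding e4 using iX iY iP iD by auto
  have P2: "expectation (\<lambda>\<omega>. (X \<omega> + Y \<omega>)\<^sup>2) =
      expectation (\<lambda>\<omega>. (X \<omega>)\<^sup>2) + expectation (\<lambda>\<omega>. (Y \<omega>)\<^sup>2) + 2 * expectation (\<lambda>\<omega>. X \<omega> * Y \<omega>)"
    using iX iY XY by (simp add: power2_sum mult.assoc)
  have D2: "expectation (\<lambda>\<omega>. (X \<omega> - Y \<omega>)\<^sup>2) =
      expectation (\<lambda>\<omega>. (X \<omega>)\<^sup>2) + expectation (\<lambda>\<omega>. (Y \<omega>)\<^sup>2) - 2 * expectation (\<lambda>\<omega>. X \<omega> * Y \<omega>)"
    using iX iY XY by (simp add: power2_diff mult.assoc)
  have "expectation (\<lambda>\<omega>. (X \<omega>)\<^sup>2 * (Y \<omega>)\<^sup>2) = (expectation (\<lambda>\<omega>. (X \<omega> + Y \<omega>) ^ 4)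
      + expectation (\<lambda>\<omega>. (X \<omega> - Y \<omega>) ^ 4) - 2 * expectation (\<lambda>\<omega>. X \<omega> ^ 4) - 2 * expectation (\<lambda>\<omega>. Y \<omega> ^ 4)) / 12"
    unfolding e4 using iX iY iP iD by simp
  \<comment> \<open>Each fourth moment is 3 times a squared second moment. With s = E X^2 + E Y^2
    and c = E XY, the first two contribute 3 (s + 2c)^2 + 3 (s - 2c)^2 = 6 s^2 + 24 c^2; subtracting
    6 (E X^2)^2 + 6 (E Y^2)^2 leaves 12 E X^2 E Y^2 + 24 c^2.\<close>
  then show "expectation (\<lambda>\<omega>. (X \<omega>)\<^sup>2 * (Y \<omega>)\<^sup>2) =
      expectation (\<lambda>\<omega>. (X \<omega>)\<^sup>2) * expectation (\<lambda>\<omega>. (Y \<omega>)\<^sup>2) + 2 * (expectation (\<lambda>\<omega>. X \<omega> * Y \<omega>))\<^sup>2"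
    using X Y P D P2 D2
    by (simp add: normal_kurtosis_def) (simp add: power2_eq_square field_simps)
qed

text \<open>Isserlis' formula is applied to every pair in the double sum for \<open>V\<close>
  squared. The products of second moments add up to the square of the mean, which the variance
  subtracts.\<close>

lemma variance_sum_squares:
  fixes X :: "'i \<Rightarrow> 'a \<Rightarrow> real"
  assumes "finite I"
    and K: "\<And>i j p q. i \<in> I \<Longrightarrow> j \<in> I \<Longrightarrow> normal_kurtosis (\<lambda>\<omega>. p * X i \<omega> + q * X j \<omega>)"
  defines "V \<equiv> \<lambda>\<omega>. \<Sum>i\<in>I. (X i \<omega>)\<^sup>2"
  shows "integrable M (\<lambda>\<omega>. (V \<omega> - expectation V)\<^sup>2)"
    and "variance V = 2 * (\<Sum>i\<in>I. \<Sum>j\<in>I. (expectation (\<lambda>\<omega>. X i \<omega> * X j \<omega>))\<^sup>2)"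
proof -
  have K1: "normal_kurtosis (X i)" if "i \<in> I" for i
    using K[OF that that, of 1 0] by simp
  note i2 = normal_kurtosis_integrable(2)[OF K1]
  note EQ = expectation_square_mult_square(1)[OF K]
  note IQ = expectation_square_mult_square(2)[OF K]
  have EV: "expectation V = (\<Sum>i\<in>I. expectation (\<lambda>\<omega>. (X i \<omega>)\<^sup>2))"
    unfolding V_def using i2 by (intro Bochner_Integration.integral_sum) auto
  have V2: "(V \<omega>)\<^sup>2 = (\<Sum>i\<in>I. \<Sum>j\<in>I. (X i \<omega>)\<^sup>2 * (X j \<omega>)\<^sup>2)" for \<omega>
    by (simp add: V_def power2_eq_square sum_product)
  have iV: "integrable M V" unfolding V_def using i2 by auto
  have iV2: "integrable M (\<lambda>\<omega>. (V \<omega>)\<^sup>2)"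
    unfolding V2 using IQ by auto
  show "integrable M (\<lambda>\<omega>. (V \<omega> - expectation V)\<^sup>2)"
    unfolding power2_diff using iV iV2 by auto
  have "expectation (\<lambda>\<omega>. (V \<omega>)\<^sup>2) = (\<Sum>i\<in>I. \<Sum>j\<in>I. expectation (\<lambda>\<omega>. (X i \<omega>)\<^sup>2 * (X j \<omega>)\<^sup>2))"
    unfolding V2 using IQ by (simp add: Bochner_Integration.integral_sum)
  also have "\<dots> = (\<Sum>i\<in>I. \<Sum>j\<in>I. expectation (\<lambda>\<omega>. (X i \<omega>)\<^sup>2) * expectation (\<lambda>\<omega>. (X j \<omega>)\<^sup>2))
      + 2 * (\<Sum>i\<in>I. \<Sum>j\<in>I. (expectation (\<lambda>\<omega>. X i \<omega> * X j \<omega>))\<^sup>2)"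
    by (simp add: EQ sum.distrib sum_distrib_left)
  also have "(\<Sum>i\<in>I. \<Sum>j\<in>I. expectation (\<lambda>\<omega>. (X i \<omega>)\<^sup>2) * expectation (\<lambda>\<omega>. (X j \<omega>)\<^sup>2)) = (expectation V)\<^sup>2"
    by (simp add: EV power2_eq_square sum_product)
  finally show "variance V = 2 * (\<Sum>i\<in>I. \<Sum>j\<in>I. (expectation (\<lambda>\<omega>. X i \<omega> * X j \<omega>))\<^sup>2)"
    using variance_eq[OF iV iV2] by simp
qed

end

section \<open>Fractional Gaussian noise\<close>

text \<open>The autocovariance at lag \<open>d\<close> of fractional Gaussian noise with unit step:
  half the second difference of |d|^(2H). The lag is real so that differences of indices may be
  negative.\<close>

definition fgn_cov :: "real \<Rightarrow> real \<Rightarrow> real" where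
  "fgn_cov H d = (\<bar>d + 1\<bar> powr (2 * H) + \<bar>d - 1\<bar> powr (2 * H) - 2 * \<bar>d\<bar> powr (2 * H)) / 2"

lemma fgn_cov_minus: "fgn_cov H (- d) = fgn_cov H d"
proof -
  have "\<bar>- d + 1\<bar> = \<bar>d - 1\<bar>" "\<bar>- d - 1\<bar> = \<bar>d + 1\<bar>" by linarith+
  then show ?thesis by (simp add: fgn_cov_def)
qed

text \<open>A second difference of m^(2H) is O(m^(2H-2)), so the squares are O(m^(4H-4)), and 4H - 4
  < -1 is the condition H < 3/4.\<close>

lemma summable_fgn_cov_square:
  assumes "0 < H" "H < 3/4"
  shows "summable (\<lambda>m::nat. (fgn_cov H (real m))\<^sup>2)"
proof (rule summable_comparison_test_bigo)
  have "(\<lambda>m::nat. (real m + 1) powr (2*H) + (real m - 1) powr (2*H) - 2 * real m powr (2*H))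
      \<in> O(\<lambda>m. real m powr (2*H-2))"
    using assms by real_asymp
  then have "(\<lambda>m::nat. ((real m + 1) powr (2*H) + (real m - 1) powr (2*H) - 2 * real m powr (2*H)) / 2)
      \<in> O(\<lambda>m. real m powr (2*H-2))"
    by simp
  also have "?this \<longleftrightarrow> (\<lambda>m::nat. fgn_cov H (real m)) \<in> O(\<lambda>m. real m powr (2*H-2))"
  proof (rule landau_o.big.in_cong)
    show "\<forall>\<^sub>F m in sequentially. ((real m + 1) powr (2*H) + (real m - 1) powr (2*H) - 2 * real m powr (2*H)) / 2
        = fgn_cov H (real m)"
      using eventually_ge_at_top[of 1] by eventually_elim (simp add: fgn_cov_def)
  qed
  finally have "(\<lambda>m::nat. (fgn_cov H (real m))\<^sup>2) \<in> O(\<lambda>m. (real m powr (2*H-2))\<^sup>2)"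
    by (rule landau_o.big_power)
  then show "(\<lambda>m::nat. (fgn_cov H (real m))\<^sup>2) \<in> O(\<lambda>m. real m powr (4*H-4))"
    by (simp add: power2_eq_square flip: powr_add)
  show "summable (\<lambda>m. norm (real m powr (4*H-4)))"
    using assms summable_real_powr_iff[of "4*H-4"] by simp
qed

text \<open>In each row the lags on either side of the diagonal are distinct natural numbers, so
  each side is bounded by the full series; this gives the factor 2.\<close>

lemma sum_fgn_cov_square_le:
  assumes "0 < H" "H < 3/4"
  shows "(\<Sum>i<n. \<Sum>j<n. (fgn_cov H (real i - real j))\<^sup>2) \<le> 2 * (\<Sum>m. (fgn_cov H (real m))\<^sup>2) * real n"
proof -
  let ?r = "\<lambda>m::nat. (fgn_cov H (real m))\<^sup>2"
  note S = summable_fgn_cov_square[OF assms]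
  have partial: "sum ?r A \<le> suminf ?r" if "finite A" for A
    using that S by (intro sum_le_suminf) auto
  have "(\<Sum>j<n. (fgn_cov H (real i - real j))\<^sup>2) \<le> 2 * suminf ?r" if "i < n" for i
  proof -
    have "(\<Sum>j<n. (fgn_cov H (real i - real j))\<^sup>2) =
        (\<Sum>j\<in>{..i}. (fgn_cov H (real i - real j))\<^sup>2) + (\<Sum>j\<in>{i<..<n}. (fgn_cov H (real i - real j))\<^sup>2)"
      using that by (subst sum.union_disjoint[symmetric]) (auto intro!: sum.cong)
    also have "(\<Sum>j\<in>{..i}. (fgn_cov H (real i - real j))\<^sup>2) = sum ?r ((\<lambda>j. i - j) ` {..i})"
      by (subst sum.reindex) (auto simp: inj_on_def of_nat_diff)
    also have "(\<Sum>j\<in>{i<..<n}. (fgn_cov H (real i - real j))\<^sup>2) = sum ?r ((\<lambda>j. j - i) ` {i<..<n})"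
      using fgn_cov_minus[of H "real i - real _"]
      by (subst sum.reindex) (auto simp: inj_on_def of_nat_diff intro!: sum.cong)
    finally show ?thesis using partial[of "(\<lambda>j. i - j) ` {..i}"] partial[of "(\<lambda>j. j - i) ` {i<..<n}"]
      by simp
  qed
  then have "(\<Sum>i<n. \<Sum>j<n. (fgn_cov H (real i - real j))\<^sup>2) \<le> (\<Sum>i<n. 2 * suminf ?r)"
    by (intro sum_mono) auto
  then show ?thesis by (simp add: mult_ac)
qed

section \<open>Moments of the quadratic variation\<close>

locale mixed_fbm = prob_space M for M :: "'a measure" +
  fixes B W :: "real \<Rightarrow> 'a \<Rightarrow> real" and T a b H :: real
  assumes T_pos: "T > 0" and a_pos: "a > 0" and b_pos: "b > 0" and H_pos: "0 < H"
    and fbm: "fractional_brownian_motion M {0..T} H B"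
    and wiener: "wiener_process M {0..T} W"
    and indep: "indep_processes M {0..T} B W"
begin

section \<open>Observation times and measurability\<close>

definition grid :: "nat \<Rightarrow> nat \<Rightarrow> real" where
  "grid n i = T * real i / real n"

lemma grid_mem: "i \<le> n \<Longrightarrow> grid n i \<in> {0..T}"
  \<comment> \<open>For n = 0 division by zero places the grid point at 0, which still lies in the
    interval.\<close>
  using T_pos by (cases "n = 0") (auto simp: grid_def field_simps)

lemma grid_less_iff: "n > 0 \<Longrightarrow> grid n i < grid n j \<longleftrightarrow> i < j"
  using T_pos by (auto simp: grid_def field_simps)

lemma increment_eq: "increment T n X i \<omega> = X (grid n (Suc i)) \<omega> - X (grid n i) \<omega>"
  by (simp add: increment_def grid_def add.commute)

lemma increment_mixed:
  "increment T n (mixed_process a b B W) i \<omega> = a * increment T n B i \<omega> + b * increment T n W i \<omega>"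
  by (simp add: increment_def mixed_process_def algebra_simps)

lemma gaussian_B: "t \<in> {0..T} \<Longrightarrow> gaussian_rv M (B t)"
  using fbm unfolding fractional_brownian_motion_def gaussian_process_def
  by (auto dest!: spec[of _ "{t}"] spec[of _ "\<lambda>_. 1"])

lemma measurable_B: "t \<in> {0..T} \<Longrightarrow> random_variable borel (B t)"
  using gaussian_B by (auto simp: gaussian_rv_def)

lemma measurable_W: "t \<in> {0..T} \<Longrightarrow> random_variable borel (W t)"
  using wiener unfolding wiener_process_def by auto

lemma measurable_increment:
  assumes "i < n"
  shows "random_variable borel (increment T n B i)" "random_variable borel (increment T n W i)"
  using assms grid_mem[of i n] grid_mem[of "Suc i" n]
  unfolding increment_eq[abs_def] by (auto intro!: borel_measurable_diff measurable_B measurable_W)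

lemma measurable_quadratic_variation:
  "random_variable borel (quadratic_variation T (mixed_process a b B W) n)"
proof -
  have "random_variable borel (increment T n (mixed_process a b B W) i)" if "i < n" for i
    using measurable_increment[OF that] unfolding increment_mixed[abs_def] by measurable
  then show ?thesis unfolding quadratic_variation_def[abs_def] by auto
qed

section \<open>Increments of the fractional Brownian motion\<close>

lemma normal_kurtosis_B_sum:
  assumes "finite F" "F \<subseteq> {0..T}"
  shows "normal_kurtosis (\<lambda>\<omega>. \<Sum>t\<in>F. c t * B t \<omega>)"
proof (rule normal_kurtosis_gaussian)
  show "gaussian_rv M (\<lambda>\<omega>. \<Sum>t\<in>F. c t * B t \<omega>)"
    using assms fbm unfolding fractional_brownian_motion_def gaussian_process_def by blast
  have "expectation (\<lambda>\<omega>. \<Sum>t\<in>F. c t * B t \<omega>) = (\<Sum>t\<in>F. c t * expectation (B t))"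
    using assms gaussian_B by (subst Bochner_Integration.integral_sum) (auto intro!: integrable_gaussian_rv)
  also have "\<dots> = 0"
    using assms fbm unfolding fractional_brownian_motion_def by (intro sum.neutral) auto
  finally show "expectation (\<lambda>\<omega>. \<Sum>t\<in>F. c t * B t \<omega>) = 0" .
qed

lemma normal_kurtosis_B_increments:
  assumes "i < n" "j < n"
  shows "normal_kurtosis (\<lambda>\<omega>. p * increment T n B i \<omega> + q * increment T n B j \<omega>)"
proof -
  let ?F = "{grid n (Suc i), grid n i, grid n (Suc j), grid n j}"
  \<comment> \<open>The four times may coincide, as for j = i or j = i + 1, and \<open>?F\<close> is
    a set. Adding indicator coefficients collects the contributions to a repeated time.\<close>
  define c where "c t = p * (of_bool (t = grid n (Suc i)) - of_bool (t = grid n i))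
      + q * (of_bool (t = grid n (Suc j)) - of_bool (t = grid n j))" for t
  have pick: "(\<Sum>t\<in>?F. of_bool (t = s) * B t \<omega>) = B s \<omega>" if "s \<in> ?F" for s \<omega>
    using sum.delta[of ?F s "\<lambda>t. B t \<omega>"] that
    by (simp only: of_bool_def if_distrib[of "\<lambda>x. x * _"] mult_1 mult_zero_left finite_insert finite.emptyI if_True)
  have "(\<Sum>t\<in>?F. c t * B t \<omega>) =
      p * ((\<Sum>t\<in>?F. of_bool (t = grid n (Suc i)) * B t \<omega>) - (\<Sum>t\<in>?F. of_bool (t = grid n i) * B t \<omega>))
      + q * ((\<Sum>t\<in>?F. of_bool (t = grid n (Suc j)) * B t \<omega>) - (\<Sum>t\<in>?F. of_bool (t = grid n j) * B t \<omega>))" for \<omega>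
    unfolding c_def
    by (simp only: sum_distrib_left flip: sum.distrib sum_subtractf) (simp only: algebra_simps)
  then have "(\<Sum>t\<in>?F. c t * B t \<omega>) = p * increment T n B i \<omega> + q * increment T n B j \<omega>" for \<omega>
    unfolding increment_eq by (simp only: pick insert_iff simp_thms)
  moreover have "normal_kurtosis (\<lambda>\<omega>. \<Sum>t\<in>?F. c t * B t \<omega>)"
    using assms grid_mem by (intro normal_kurtosis_B_sum) auto
  ultimately show ?thesis by simp
qed

lemma normal_kurtosis_B_increment: "i < n \<Longrightarrow> normal_kurtosis (increment T n B i)"
  using normal_kurtosis_B_increments[of i n i 1 0] by simp

text \<open>Self-similarity pulls out the factor \<open>(T / real n) powr (2 * H)\<close>. In the
  signed sum of the four covariances the powers of single indices cancel, and the powers of index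
  differences form the second difference at lag i - j.\<close>

lemma expectation_B_increments:
  assumes "i < n" "j < n"
  shows "expectation (\<lambda>\<omega>. increment T n B i \<omega> * increment T n B j \<omega>) =
    (T / real n) powr (2 * H) * fgn_cov H (real i - real j)"
proof -
  have int: "integrable M (\<lambda>\<omega>. B s \<omega> * B t \<omega>)" if "s \<in> {0..T}" "t \<in> {0..T}" for s t
  proof (rule integrable_mult_square_integrable)
    show "integrable M (\<lambda>\<omega>. (B s \<omega>)\<^sup>2)" "integrable M (\<lambda>\<omega>. (B t \<omega>)\<^sup>2)"
      using normal_kurtosis_integrable(2)[OF normal_kurtosis_B_sum[of "{_}" "\<lambda>_. 1"]] that by auto
  qed (use that measurable_B in auto)
  have cov: "expectation (\<lambda>\<omega>. B (grid n k) \<omega> * B (grid n l) \<omega>) =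
      (T / real n) powr (2 * H) * (real k powr (2 * H) + real l powr (2 * H) - \<bar>real k - real l\<bar> powr (2 * H)) / 2"
    if "k \<le> n" "l \<le> n" for k l
  proof -
    have "expectation (\<lambda>\<omega>. B (grid n k) \<omega> * B (grid n l) \<omega>) =
      (grid n k powr (2 * H) + grid n l powr (2 * H) - \<bar>grid n k - grid n l\<bar> powr (2 * H)) / 2"
      using fbm that grid_mem unfolding fractional_brownian_motion_def by blast
    moreover have g: "grid n m = (T / real n) * real m" for m by (simp add: grid_def)
    moreover have "\<bar>grid n k - grid n l\<bar> = (T / real n) * \<bar>real k - real l\<bar>"
      using T_pos unfolding g right_diff_distrib[symmetric] abs_mult by simp
    moreover have "(T / real n * x) powr (2 * H) = (T / real n) powr (2 * H) * x powr (2 * H)" for x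
      by (rule powr_mult)
    ultimately show ?thesis
      by (simp add: right_diff_distrib distrib_left)
  qed
  have mem: "grid n i \<in> {0..T}" "grid n (Suc i) \<in> {0..T}" "grid n j \<in> {0..T}" "grid n (Suc j) \<in> {0..T}"
    using assms grid_mem by auto
  have "expectation (\<lambda>\<omega>. increment T n B i \<omega> * increment T n B j \<omega>) =
      expectation (\<lambda>\<omega>. B (grid n (Suc i)) \<omega> * B (grid n (Suc j)) \<omega> - B (grid n (Suc i)) \<omega> * B (grid n j) \<omega>
        - B (grid n i) \<omega> * B (grid n (Suc j)) \<omega> + B (grid n i) \<omega> * B (grid n j) \<omega>)"
    by (simp add: increment_eq algebra_simps)
  also have "\<dots> = (T / real n) powr (2 * H) * fgn_cov H (real i - real j)"
  proof -
    have "\<bar>1 + real i - real j\<bar> = \<bar>real i - real j + 1\<bar>" "\<bar>real i - (1 + real j)\<bar> = \<bar>real i - real j - 1\<bar>"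
      "\<bar>real j - (1 + real i)\<bar> = \<bar>1 + real i - real j\<bar>"
      by linarith+
    then show ?thesis
      using int mem assms by (simp add: cov fgn_cov_def field_simps)
  qed
  finally show ?thesis .
qed

section \<open>Increments of the Wiener process\<close>

lemma W_increment_normal:
  assumes "i < n"
  shows "distributed M lborel (increment T n W i) (\<lambda>x. ennreal (normal_density 0 (sqrt (T / real n)) x))"
proof -
  have "grid n i < grid n (Suc i)" using assms by (simp add: grid_less_iff)
  moreover have "grid n (Suc i) - grid n i = T / real n" using assms by (simp add: grid_def field_simps)
  ultimately show ?thesis
    using wiener assms grid_mem[of i n] grid_mem[of "Suc i" n]
    unfolding wiener_process_def increment_eq[abs_def] by (metis Suc_leI less_imp_le_nat)
qed

lemma indep_W_increments:
  assumes "i < n" "j < n" "i \<noteq> j"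
  shows "indep_var borel (increment T n W i) borel (increment T n W j)"
proof -
  have "strict_mono_on {..n} (grid n) \<and> grid n ` {..n} \<subseteq> {0..T}"
    using assms grid_less_iff[of n] grid_mem[of _ n] by (auto simp: strict_mono_on_def)
  then have "indep_vars (\<lambda>_. borel) (\<lambda>i \<omega>. W (grid n (Suc i)) \<omega> - W (grid n i) \<omega>) {..<n}"
    using wiener unfolding wiener_process_def by blast
  then have "indep_vars (\<lambda>_. borel) (increment T n W) {..<n}"
    unfolding increment_eq[abs_def] .
  \<comment> \<open>Pairwise independence is read off from the family by restricting it to two
    disjoint singletons and then projecting to the only coordinate.\<close>
  from indep_var_restrict[OF this, of "{i}" "{j}"]
  have "indep_var (PiM {i} (\<lambda>_. borel)) (\<lambda>\<omega>. \<lambda>k\<in>{i}. increment T n W k \<omega>)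
      (PiM {j} (\<lambda>_. borel)) (\<lambda>\<omega>. \<lambda>k\<in>{j}. increment T n W k \<omega>)"
    using assms by auto
  from indep_var_compose[OF this, of "\<lambda>x. x i" borel "\<lambda>x. x j" borel] show ?thesis
    by (simp add: comp_def)
qed

lemma normal_kurtosis_W_increment:
  assumes "i < n"
  shows "normal_kurtosis (increment T n W i)"
  by (rule normal_kurtosis_normal[OF W_increment_normal[OF assms]]) (use T_pos assms in simp)

text \<open>For distinct indices the summands are independent; on the diagonal the combination is
  the multiple p + q of a single increment.\<close>

lemma normal_kurtosis_W_increments:
  assumes "i < n" "j < n"
  shows "normal_kurtosis (\<lambda>\<omega>. p * increment T n W i \<omega> + q * increment T n W j \<omega>)"
proof (cases "i = j")
  case True
  then show ?thesis
    using normal_kurtosis_scale[OF normal_kurtosis_W_increment[OF assms(1)], of "p + q"]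
    by (simp add: distrib_right)
next
  case False
  have "indep_var borel (\<lambda>\<omega>. p * increment T n W i \<omega>) borel (\<lambda>\<omega>. q * increment T n W j \<omega>)"
    using indep_var_compose[OF indep_W_increments[OF assms False], of "\<lambda>x. p * x" borel "\<lambda>x. q * x" borel]
    by (simp add: comp_def)
  then show ?thesis
    using assms by (intro normal_kurtosis_add_indep normal_kurtosis_scale normal_kurtosis_W_increment)
qed

lemma expectation_W_increments:
  assumes "i < n" "j < n"
  shows "expectation (\<lambda>\<omega>. increment T n W i \<omega> * increment T n W j \<omega>) = of_bool (i = j) * (T / real n)"
proof (cases "i = j")
  case True
  have "variance (increment T n W i) = T / real n"
    using normal_distributed_variance[OF _ W_increment_normal[OF assms(1)]] T_pos assms by simp
  moreover have "expectation (increment T n W i) = 0"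
    using normal_kurtosis_W_increment[OF assms(1)] by (simp add: normal_kurtosis_def)
  ultimately show ?thesis using True by (simp add: power2_eq_square)
next
  case False
  then show ?thesis
    using indep_var_lebesgue_integral[OF indep_W_increments[OF assms False]] assms
      normal_kurtosis_W_increment
    by (simp add: normal_kurtosis_integrable(1)) (simp add: normal_kurtosis_def)
qed

section \<open>Independence of both processes and increments of the mixture\<close>

lemma indep_B_W_increments:
  assumes "i < n" "j < n" "k < n" "l < n"
  shows "indep_var borel (\<lambda>\<omega>. p * increment T n B i \<omega> + q * increment T n B j \<omega>)
    borel (\<lambda>\<omega>. r * increment T n W k \<omega> + s * increment T n W l \<omega>)"
proof -
  have mem: "grid n m \<in> {0..T}" if "m \<in> {i, j, k, l, Suc i, Suc j, Suc k, Suc l}" for m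
    using that assms grid_mem by auto
  \<comment> \<open>As a functional on path space \<open>f\<close> reads finitely many coordinates,
    hence is measurable for the product sigma-algebra, and independence of the two path-valued
    variables passes to its values.\<close>
  define f where "f p q i j x = p * (x (grid n (Suc i)) - x (grid n i)) + q * (x (grid n (Suc j)) - x (grid n j))"
    for p q :: real and i j and x :: "real \<Rightarrow> real"
  have "f p q i j \<in> borel_measurable (PiM {0..T} (\<lambda>_. borel))" "f r s k l \<in> borel_measurable (PiM {0..T} (\<lambda>_. borel))"
    unfolding f_def using mem
    by (auto intro!: borel_measurable_add borel_measurable_diff borel_measurable_times measurable_component_singleton)
  from indep_var_compose[OF indep[unfolded indep_processes_def] this] show ?thesis
    using mem by (simp add: comp_def f_def increment_eq)
qed

text \<open>Regrouping separates a combination of increments of \<open>B\<close> from an independent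
  one of increments of \<open>W\<close>. The result is the hypothesis of
  \<open>variance_sum_squares\<close> for the mixture.\<close>

lemma normal_kurtosis_mixed_increments:
  assumes "i < n" "j < n"
  shows "normal_kurtosis (\<lambda>\<omega>. p * increment T n (mixed_process a b B W) i \<omega>
    + q * increment T n (mixed_process a b B W) j \<omega>)"
proof -
  have "normal_kurtosis (\<lambda>\<omega>. ((p * a) * increment T n B i \<omega> + (q * a) * increment T n B j \<omega>)
      + ((p * b) * increment T n W i \<omega> + (q * b) * increment T n W j \<omega>))"
    using assms by (intro normal_kurtosis_add_indep indep_B_W_increments
        normal_kurtosis_B_increments normal_kurtosis_W_increments)
  then show ?thesis by (simp add: increment_mixed algebra_simps)
qed

text \<open>The cross terms between \<open>B\<close> and \<open>W\<close> vanish by independence and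
  zero means, so the two covariances add.\<close>

lemma expectation_mixed_increments:
  assumes "i < n" "j < n"
  shows "expectation (\<lambda>\<omega>. increment T n (mixed_process a b B W) i \<omega> * increment T n (mixed_process a b B W) j \<omega>) =
    a\<^sup>2 * (T / real n) powr (2 * H) * fgn_cov H (real i - real j) + b\<^sup>2 * of_bool (i = j) * (T / real n)"
proof -
  have cross: "integrable M (\<lambda>\<omega>. increment T n B k \<omega> * increment T n W l \<omega>)"
    "expectation (\<lambda>\<omega>. increment T n B k \<omega> * increment T n W l \<omega>) = 0" if "k < n" "l < n" for k l
  proof -
    have ind: "indep_var borel (increment T n B k) borel (increment T n W l)"
      using indep_B_W_increments[OF that(1,1,2,2), of 1 0 1 0] by simp
    note i = normal_kurtosis_integrable(1)[OF normal_kurtosis_B_increment[OF that(1)]]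
      normal_kurtosis_integrable(1)[OF normal_kurtosis_W_increment[OF that(2)]]
    show "integrable M (\<lambda>\<omega>. increment T n B k \<omega> * increment T n W l \<omega>)"
      by (rule indep_var_integrable[OF ind i])
    show "expectation (\<lambda>\<omega>. increment T n B k \<omega> * increment T n W l \<omega>) = 0"
      using indep_var_lebesgue_integral[OF ind i] normal_kurtosis_B_increment[OF that(1)]
      by (simp add: normal_kurtosis_def)
  qed
  have BB: "integrable M (\<lambda>\<omega>. increment T n B i \<omega> * increment T n B j \<omega>)"
    and WW: "integrable M (\<lambda>\<omega>. increment T n W i \<omega> * increment T n W j \<omega>)"
    using assms normal_kurtosis_B_increment normal_kurtosis_W_increment
    by (auto intro!: integrable_mult_square_integrable measurable_increment normal_kurtosis_integrable(2))
  have split: "increment T n (mixed_process a b B W) i \<omega> * increment T n (mixed_process a b B W) j \<omega> =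
      a\<^sup>2 * (increment T n B i \<omega> * increment T n B j \<omega>) + b\<^sup>2 * (increment T n W i \<omega> * increment T n W j \<omega>)
      + (a * b) * (increment T n B i \<omega> * increment T n W j \<omega>) + (a * b) * (increment T n B j \<omega> * increment T n W i \<omega>)"
    for \<omega>
    by (simp add: increment_mixed power2_eq_square algebra_simps)
  show ?thesis
    unfolding split using assms BB WW cross(1)[OF assms] cross(1)[OF assms(2,1)]
    by (simp add: cross(2) expectation_B_increments expectation_W_increments)
qed

section \<open>Mean and variance of the quadratic variation\<close>

abbreviation QV :: "nat \<Rightarrow> 'a \<Rightarrow> real" where
  "QV \<equiv> quadratic_variation T (mixed_process a b B W)"

lemma expectation_QV:
  assumes "n > 0"
  shows "expectation (QV n) = a\<^sup>2 * T powr (2 * H) * real n powr (1 - 2 * H) + b\<^sup>2 * T"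
proof -
  have "expectation (QV n) = (\<Sum>i<n. expectation (\<lambda>\<omega>. (increment T n (mixed_process a b B W) i \<omega>)\<^sup>2))"
    unfolding quadratic_variation_def
    using normal_kurtosis_mixed_increments[of _ n _ 1 0]
    by (intro Bochner_Integration.integral_sum) (auto intro!: normal_kurtosis_integrable)
  \<comment> \<open>All n diagonal terms agree because \<open>fgn_cov H 0 = 1\<close>.\<close>
  also have "\<dots> = (\<Sum>i<n. a\<^sup>2 * (T / real n) powr (2 * H) + b\<^sup>2 * (T / real n))"
    by (intro sum.cong)
       (auto simp: power2_eq_square expectation_mixed_increments[unfolded power2_eq_square] fgn_cov_def)
  also have "\<dots> = a\<^sup>2 * T powr (2 * H) * real n powr (1 - 2 * H) + b\<^sup>2 * T"
    using assms T_pos by (simp add: powr_divide powr_diff field_simps)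
  finally show ?thesis .
qed

text \<open>The fractional part contributes n^(-4H) times a double sum of order n, the Wiener part n
  diagonal terms of order n^(-2). The constant is uniform in n.\<close>

lemma variance_QV_le:
  assumes "H < 3/4"
  obtains C where "\<And>n. n > 0 \<Longrightarrow> variance (QV n) \<le> C * (real n powr (1 - 4 * H) + real n powr (-1))"
    and "\<And>n. n > 0 \<Longrightarrow> integrable M (\<lambda>\<omega>. (QV n \<omega> - expectation (QV n))\<^sup>2)"
proof -
  define S where "S = (\<Sum>m. (fgn_cov H (real m))\<^sup>2)"
  have "S \<ge> 0" unfolding S_def using summable_fgn_cov_square[OF H_pos assms] by (rule suminf_nonneg) auto
  \<comment> \<open>A factor 2 comes from \<open>variance_sum_squares\<close> and another from (x +
    y)^2 \<le> 2x^2 + 2y^2; the fractional part carries a third from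
    \<open>sum_fgn_cov_square_le\<close>.\<close>
  define C where "C = 8 * a ^ 4 * T powr (4 * H) * S + 4 * b ^ 4 * T\<^sup>2"
  have "variance (QV n) \<le> C * (real n powr (1 - 4 * H) + real n powr (-1))" if n: "n > 0" for n
  proof -
    let ?d = "(T / real n) powr (2 * H)"
    have d2: "?d\<^sup>2 * real n = T powr (4 * H) * real n powr (1 - 4 * H)"
    proof -
      have "?d\<^sup>2 = T powr (4 * H) / real n powr (4 * H)"
        using n T_pos by (simp add: powr_divide power2_eq_square flip: powr_add)
      then show ?thesis using n by (simp add: powr_diff)
    qed
    have "variance (QV n) = 2 * (\<Sum>i<n. \<Sum>j<n. (a\<^sup>2 * ?d * fgn_cov H (real i - real j) + b\<^sup>2 * of_bool (i = j) * (T / real n))\<^sup>2)"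
      unfolding quadratic_variation_def
      by (subst variance_sum_squares(2)) (auto intro!: normal_kurtosis_mixed_increments simp: expectation_mixed_increments)
    also have "\<dots> \<le> 2 * (\<Sum>i<n. \<Sum>j<n. 2 * (a ^ 4 * ?d\<^sup>2 * (fgn_cov H (real i - real j))\<^sup>2) + 2 * (of_bool (i = j) * (b ^ 4 * (T / real n)\<^sup>2)))"
    proof (intro mult_left_mono sum_mono)
      fix i j :: nat
      have "(x + y)\<^sup>2 \<le> 2 * x\<^sup>2 + 2 * y\<^sup>2" for x y :: real
        using zero_le_power2[of "x - y"] by (simp add: power2_sum power2_diff)
      from this[of "a\<^sup>2 * ?d * fgn_cov H (real i - real j)" "b\<^sup>2 * of_bool (i = j) * (T / real n)"]
      moreover have "(b\<^sup>2 * of_bool (i = j) * (T / real n))\<^sup>2 = of_bool (i = j) * (b ^ 4 * (T / real n)\<^sup>2)"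
        by (cases "i = j") (simp_all add: power_mult_distrib power_divide flip: power_mult)
      moreover have "(a\<^sup>2 * ?d * fgn_cov H (real i - real j))\<^sup>2 = a ^ 4 * ?d\<^sup>2 * (fgn_cov H (real i - real j))\<^sup>2"
        by (simp add: power_mult_distrib flip: power_mult)
      ultimately
      show "(a\<^sup>2 * ?d * fgn_cov H (real i - real j) + b\<^sup>2 * of_bool (i = j) * (T / real n))\<^sup>2
          \<le> 2 * (a ^ 4 * ?d\<^sup>2 * (fgn_cov H (real i - real j))\<^sup>2) + 2 * (of_bool (i = j) * (b ^ 4 * (T / real n)\<^sup>2))"
        by simp
    qed auto
    also have "\<dots> = 4 * a ^ 4 * ?d\<^sup>2 * (\<Sum>i<n. \<Sum>j<n. (fgn_cov H (real i - real j))\<^sup>2) + 4 * (b ^ 4 * (T / real n)\<^sup>2) * real n"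
      by (simp add: sum.distrib flip: sum_distrib_left sum_distrib_right)
    also have "\<dots> \<le> 4 * a ^ 4 * ?d\<^sup>2 * (2 * S * real n) + 4 * (b ^ 4 * (T / real n)\<^sup>2) * real n"
      unfolding S_def using sum_fgn_cov_square_le[OF H_pos assms, of n]
      by (intro add_right_mono mult_left_mono) auto
    also have "\<dots> = 8 * a ^ 4 * T powr (4 * H) * S * real n powr (1 - 4 * H) + 4 * b ^ 4 * T\<^sup>2 * real n powr (-1)"
    proof -
      have "4 * a ^ 4 * ?d\<^sup>2 * (2 * S * real n) = 8 * a ^ 4 * S * (?d\<^sup>2 * real n)" by (simp only: mult_ac)
      moreover have "(T / real n)\<^sup>2 * real n = T\<^sup>2 * real n powr (-1)"
        using n by (simp add: powr_minus power2_eq_square field_simps)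
      ultimately show ?thesis by (simp only: d2 mult.assoc) (simp add: mult_ac)
    qed
    also have "\<dots> \<le> C * (real n powr (1 - 4 * H) + real n powr (-1))"
      unfolding C_def using \<open>S \<ge> 0\<close> by (simp add: algebra_simps)
    finally show ?thesis .
  qed
  moreover have "integrable M (\<lambda>\<omega>. (QV n \<omega> - expectation (QV n))\<^sup>2)" for n
    using variance_sum_squares(1)[of "{..<n}" "increment T n (mixed_process a b B W)"]
      normal_kurtosis_mixed_increments
    unfolding quadratic_variation_def by simp
  ultimately show ?thesis using that by blast
qed

end

section \<open>Almost sure asymptotics\<close>

text \<open>By monotone convergence the series of the squares has finite expectation, so it
  converges almost surely and its terms tend to 0.\<close>

lemma (in prob_space) AE_tendsto_zero_if_summable_second_moment:
  fixes Z :: "nat \<Rightarrow> 'a \<Rightarrow> real"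
  assumes [measurable]: "\<And>k. random_variable borel (Z k)"
    and int: "\<And>k. integrable M (\<lambda>\<omega>. (Z k \<omega>)\<^sup>2)"
    and le: "\<And>k. expectation (\<lambda>\<omega>. (Z k \<omega>)\<^sup>2) \<le> c k" and c: "summable c"
  shows "AE \<omega> in M. (\<lambda>k. Z k \<omega>) \<longlonglongrightarrow> 0"
proof -
  have nonneg: "0 \<le> expectation (\<lambda>\<omega>. (Z k \<omega>)\<^sup>2)" for k by simp
  have sE: "summable (\<lambda>k. expectation (\<lambda>\<omega>. (Z k \<omega>)\<^sup>2))"
    using le nonneg by (intro summable_comparison_test[OF _ c]) auto
  have "(\<integral>\<^sup>+\<omega>. (\<Sum>k. ennreal ((Z k \<omega>)\<^sup>2)) \<partial>M) = (\<Sum>k. ennreal (expectation (\<lambda>\<omega>. (Z k \<omega>)\<^sup>2)))"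
    using int by (simp add: nn_integral_suminf nn_integral_eq_integral)
  also have "\<dots> = ennreal (\<Sum>k. expectation (\<lambda>\<omega>. (Z k \<omega>)\<^sup>2))"
    using sE nonneg by (intro suminf_ennreal2) auto
  finally have "AE \<omega> in M. (\<Sum>k. ennreal ((Z k \<omega>)\<^sup>2)) \<noteq> \<infinity>"
    by (intro nn_integral_PInf_AE) auto
  then show ?thesis
  proof eventually_elim
    case (elim \<omega>)
    then have "summable (\<lambda>k. (Z k \<omega>)\<^sup>2)"
      by (intro summable_suminf_not_top) auto
    then have "(\<lambda>k. sqrt ((Z k \<omega>)\<^sup>2)) \<longlonglongrightarrow> sqrt 0"
      by (intro tendsto_real_sqrt summable_LIMSEQ_zero)
    then show ?case by (simp add: tendsto_rabs_zero_iff)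
  qed
qed

text \<open>Along almost every path the indicators of the deviation events are eventually 0;
  dominated convergence with bound 1 gives the limit of their probabilities.\<close>

lemma consistent_if_strongly_consistent:
  assumes "prob_space M" "strongly_consistent M est \<theta>"
  shows "consistent M est \<theta>"
proof -
  interpret prob_space M by fact
  have [measurable]: "random_variable borel (est k)" for k
    using assms(2) by (simp add: strongly_consistent_def)
  have AE: "AE \<omega> in M. (\<lambda>k. est k \<omega>) \<longlonglongrightarrow> \<theta>"
    using assms(2) by (simp add: strongly_consistent_def)
  have "(\<lambda>k. prob {\<omega> \<in> space M. \<bar>est k \<omega> - \<theta>\<bar> > \<delta>}) \<longlonglongrightarrow> 0" if "\<delta> > 0" for \<delta>
  proof -
    let ?A = "\<lambda>k. {\<omega> \<in> space M. \<bar>est k \<omega> - \<theta>\<bar> > \<delta>}"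
    have "(\<lambda>k. expectation (indicator (?A k))) \<longlonglongrightarrow> expectation (\<lambda>_. 0 :: real)"
    proof (rule integral_dominated_convergence[where w = "\<lambda>_. 1"])
      show "AE \<omega> in M. (\<lambda>k. indicator (?A k) \<omega> :: real) \<longlonglongrightarrow> 0"
        using AE
      proof eventually_elim
        case (elim \<omega>)
        then have "\<forall>\<^sub>F k in sequentially. dist (est k \<omega>) \<theta> < \<delta>"
          using that by (rule tendstoD)
        then have "\<forall>\<^sub>F k in sequentially. indicator (?A k) \<omega> = (0 :: real)"
          by eventually_elim (auto simp: dist_real_def indicator_def)
        then show ?case by (rule tendsto_eventually)
      qed
    qed (auto simp: indicator_def)
    then show ?thesis by simp
  qed
  then show ?thesis by (simp add: consistent_def)
qed

section \<open>Landau calculus and rates along powers of two\<close>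

lemma log2_one_plus_bigo:
  fixes d :: "nat \<Rightarrow> real"
  assumes "d \<longlonglongrightarrow> 0"
  shows "(\<lambda>k. log 2 (1 + d k)) \<in> O(d)"
proof -
  have "(\<lambda>k. ln (1 + d k)) \<in> O(d)"
  proof (rule bigoI[where c = 2])
    have "\<forall>\<^sub>F k in sequentially. \<bar>d k\<bar> < 1/2"
      using tendstoD[OF assms, of "1/2"] by (simp add: dist_real_def)
    then show "\<forall>\<^sub>F k in sequentially. norm (ln (1 + d k)) \<le> 2 * norm (d k)"
    proof eventually_elim
      case (elim k)
      have "\<bar>ln (1 + d k)\<bar> \<le> \<bar>d k\<bar> + 2 * (d k)\<^sup>2"
        using abs_ln_one_plus_x_minus_x_bound[of "d k"] elim by linarith
      \<comment> \<open>With |d| < 1/2 the quadratic remainder 2 d^2 is at most |d|, hence the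
        constant 2.\<close>
      also have "(d k)\<^sup>2 \<le> 1/2 * \<bar>d k\<bar>"
        using mult_right_mono[of "\<bar>d k\<bar>" "1/2" "\<bar>d k\<bar>"] elim by (simp add: power2_eq_square)
      finally show ?case by simp
    qed
  qed
  then show ?thesis by (simp add: log_def)
qed

text \<open>The bounded quotient r / (f + g) is distributed over the two summands. Positivity for
  every k makes the splitting exact for every k, not only eventually.\<close>

lemma bigo_add_split:
  fixes r f g :: "nat \<Rightarrow> real"
  assumes r: "r \<in> O(\<lambda>k. f k + g k)" and pos: "\<And>k. f k + g k > 0"
  obtains r1 r2 where "r1 \<in> O(f)" "r2 \<in> O(g)" "\<And>k. r k = r1 k + r2 k"
proof
  let ?q = "\<lambda>k. r k / (f k + g k)"
  have nz: "f k + g k \<noteq> 0" for k using pos[of k] by simp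
  have q: "?q \<in> O(\<lambda>_. 1)" using r nz by (simp add: landau_divide_simps)
  show "(\<lambda>k. ?q k * f k) \<in> O(f)" using landau_o.big.mult[OF q landau_o.big_refl[of f]] by simp
  show "(\<lambda>k. ?q k * g k) \<in> O(g)" using landau_o.big.mult[OF q landau_o.big_refl[of g]] by simp
  show "r k = ?q k * f k + ?q k * g k" for k using nz[of k] by (simp flip: distrib_left add_divide_distrib)
qed

text \<open>The same splitting, with a quotient that tends to 0.\<close>

lemma smallo_add_split:
  fixes r f g :: "nat \<Rightarrow> real"
  assumes r: "r \<in> o(\<lambda>k. f k + g k)" and pos: "\<And>k. f k + g k > 0"
  obtains r1 r2 where "r1 \<in> o(f)" "r2 \<in> o(g)" "\<And>k. r k = r1 k + r2 k"
proof
  let ?q = "\<lambda>k. r k / (f k + g k)"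
  have nz: "f k + g k \<noteq> 0" for k using pos[of k] by simp
  have q: "?q \<in> o(\<lambda>_. 1)" using r nz by (simp add: landau_divide_simps)
  show "(\<lambda>k. ?q k * f k) \<in> o(f)" using landau_o.small_big_mult[OF q landau_o.big_refl[of f]] by simp
  show "(\<lambda>k. ?q k * g k) \<in> o(g)" using landau_o.small_big_mult[OF q landau_o.big_refl[of g]] by simp
  show "r k = ?q k * f k + ?q k * g k" for k using nz[of k] by (simp flip: distrib_left add_divide_distrib)
qed

text \<open>With n = 2^k this is n^(-1/2+\<epsilon>) + n^(2H-3/2+\<epsilon>). Both error terms are
  carried as one rate and separated only at the end by \<open>err_rate_split\<close>.\<close>

definition err_rate :: "real \<Rightarrow> real \<Rightarrow> nat \<Rightarrow> real" where
  "err_rate H \<epsilon> k = 2 powr (real k * (-1/2 + \<epsilon>)) + 2 powr (real k * (2 * H - 3/2 + \<epsilon>))"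

lemma err_rate_pos: "err_rate H \<epsilon> k > 0"
  by (simp add: err_rate_def add_pos_pos)

lemma err_rate_mono: "\<epsilon> \<le> \<epsilon>' \<Longrightarrow> err_rate H \<epsilon> k \<le> err_rate H \<epsilon>' k"
  unfolding err_rate_def by (intro add_mono powr_mono mult_left_mono) auto

lemma err_rate_bigo_mono: "\<epsilon> \<le> \<epsilon>' \<Longrightarrow> err_rate H \<epsilon> \<in> O(err_rate H \<epsilon>')"
  using err_rate_mono err_rate_pos by (intro bigoI[where c = 1]) (auto simp: less_imp_le)

lemma two_powr_tendsto_0:
  assumes "\<alpha> < 0"
  shows "(\<lambda>k. 2 powr (real k * \<alpha>)) \<longlonglongrightarrow> 0"
proof -
  have "2 powr \<alpha> < (1 :: real)" using assms by (simp add: powr_less_one)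
  then have "(\<lambda>k. (2 powr \<alpha>) ^ k) \<longlonglongrightarrow> (0 :: real)" by (intro LIMSEQ_realpow_zero) auto
  then show ?thesis by (simp add: powr_powr mult.commute flip: powr_realpow)
qed

lemma bigo_tendsto_0:
  fixes r d :: "nat \<Rightarrow> real"
  assumes "r \<in> O(d)" "d \<longlonglongrightarrow> 0"
  shows "r \<longlonglongrightarrow> 0"
proof -
  have "d \<in> o(\<lambda>_. 1)" using assms(2) by (intro smalloI_tendsto) auto
  from smalloD_tendsto[OF landau_o.big_small_trans[OF assms(1) this]] show ?thesis by simp
qed

lemma err_rate_tendsto_0:
  assumes "\<epsilon> < 1/2" "\<epsilon> < 3/2 - 2 * H"
  shows "err_rate H \<epsilon> \<longlonglongrightarrow> 0"
  unfolding err_rate_def[abs_def] using assms by (intro tendsto_add_zero two_powr_tendsto_0) auto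

text \<open>Passing to the next level multiplies each summand by a constant. This serves
  \<open>hurst_est_b\<close>, which compares the levels k and k + 1.\<close>

lemma err_rate_Suc: "(\<lambda>k. err_rate H \<epsilon> (Suc k)) \<in> O(err_rate H \<epsilon>)"
proof (rule bigoI[where c = "2 powr (-1/2 + \<epsilon>) + 2 powr (2 * H - 3/2 + \<epsilon>)"])
  have "err_rate H \<epsilon> (Suc k) \<le> (2 powr (-1/2 + \<epsilon>) + 2 powr (2 * H - 3/2 + \<epsilon>)) * err_rate H \<epsilon> k" for k
  proof -
    have "err_rate H \<epsilon> (Suc k) = 2 powr (-1/2 + \<epsilon>) * 2 powr (real k * (-1/2 + \<epsilon>))
        + 2 powr (2 * H - 3/2 + \<epsilon>) * 2 powr (real k * (2 * H - 3/2 + \<epsilon>))"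
      by (simp add: err_rate_def distrib_right flip: powr_add)
    also have "\<dots> \<le> (2 powr (-1/2 + \<epsilon>) + 2 powr (2 * H - 3/2 + \<epsilon>)) * err_rate H \<epsilon> k"
      by (simp add: err_rate_def distrib_left distrib_right)
    finally show ?thesis .
  qed
  then show "\<forall>\<^sub>F k in sequentially. norm (err_rate H \<epsilon> (Suc k)) \<le>
      (2 powr (-1/2 + \<epsilon>) + 2 powr (2 * H - 3/2 + \<epsilon>)) * norm (err_rate H \<epsilon> k)"
    using err_rate_pos[of H \<epsilon>] by (auto simp: less_imp_le abs_of_pos)
qed

text \<open>The common core of \<open>hurst_est_a\<close> and \<open>hurst_est_ab\<close>. The
  logarithm of the leading factor turns the numerator into 2H (k - log T) minus the logarithm of 1 +
  d, so the estimator misses H only by the latter over the denominator.\<close>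

lemma log_estimator_error:
  fixes x d :: "nat \<Rightarrow> real"
  assumes "T > 0" "a > 0" and d: "d \<longlonglongrightarrow> 0"
    and x: "\<And>k. x k = a\<^sup>2 * T powr (2 * H) * 2 powr (real k * (1 - 2 * H)) * (1 + d k)"
  shows "(\<lambda>k. (real k + 2 * log 2 a - log 2 (x k)) / (2 * (real k - log 2 T)) - H) \<in> O(d)"
    and "\<forall>\<^sub>F k in sequentially. x k > 0"
proof -
  have ev: "\<forall>\<^sub>F k in sequentially. 1 + d k > 0"
    using order_tendstoD(1)[OF d, of "-1"] by (simp add: eventually_mono)
  then show "\<forall>\<^sub>F k in sequentially. x k > 0"
    by eventually_elim (use assms in \<open>simp add: x\<close>)
  \<comment> \<open>From here on the denominator is at least 2, so dividing by it cannot enlarge the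
    error.\<close>
  have large: "\<forall>\<^sub>F k in sequentially. real k \<ge> log 2 T + 1"
    by real_asymp
  have "(\<lambda>k. (real k + 2 * log 2 a - log 2 (x k)) / (2 * (real k - log 2 T)) - H) \<in> O(\<lambda>k. log 2 (1 + d k))"
  proof (rule bigoI[where c = 1])
    show "\<forall>\<^sub>F k in sequentially. norm ((real k + 2 * log 2 a - log 2 (x k)) / (2 * (real k - log 2 T)) - H)
        \<le> 1 * norm (log 2 (1 + d k))"
      using ev large
    proof eventually_elim
      case (elim k)
      have "log 2 (x k) = 2 * log 2 a + 2 * H * log 2 T + real k * (1 - 2 * H) + log 2 (1 + d k)"
        using elim assms by (simp add: x log_mult log_powr log_nat_power)
      then have "(real k + 2 * log 2 a - log 2 (x k)) / (2 * (real k - log 2 T)) - H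
          = - log 2 (1 + d k) / (2 * (real k - log 2 T))"
        using elim by (simp add: field_simps)
      moreover have "\<bar>log 2 (1 + d k)\<bar> / (2 * (real k - log 2 T)) \<le> \<bar>log 2 (1 + d k)\<bar> / 1"
        using elim by (intro divide_left_mono) auto
      ultimately show ?case using elim by (simp add: abs_divide)
    qed
  qed
  also note log2_one_plus_bigo[OF d]
  finally show "(\<lambda>k. (real k + 2 * log 2 a - log 2 (x k)) / (2 * (real k - log 2 T)) - H) \<in> O(d)" .
qed

lemma err_rate_split:
  assumes "r \<in> o(err_rate H \<epsilon>)"
  shows "\<exists>r1 r2. r1 \<in> o(\<lambda>k. 2 powr (real k * (-1/2 + \<epsilon>))) \<and>
    r2 \<in> o(\<lambda>k. 2 powr (real k * (2 * H - 3/2 + \<epsilon>))) \<and> (\<forall>k. r k = r1 k + r2 k)"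
  using smallo_add_split[OF assms[unfolded err_rate_def[abs_def]] err_rate_pos[unfolded err_rate_def]]
  by metis

section \<open>Relative error of the quadratic variation\<close>

context mixed_fbm
begin

text \<open>The denominator is the fractional part of the mean, that is, the mean of
  \<open>QV (2 ^ k)\<close> minus b^2 T.\<close>

definition rel_err :: "nat \<Rightarrow> 'a \<Rightarrow> real" where
  "rel_err k \<omega> = (QV (2 ^ k) \<omega> - expectation (QV (2 ^ k))) /
     (a\<^sup>2 * T powr (2 * H) * 2 powr (real k * (1 - 2 * H)))"

lemma two_power_powr: "real (2 ^ k) powr c = 2 powr (real k * c)"
  by (simp add: powr_powr flip: powr_realpow)

lemma QV_eq:
  "QV (2 ^ k) \<omega> - b\<^sup>2 * T = a\<^sup>2 * T powr (2 * H) * 2 powr (real k * (1 - 2 * H)) * (1 + rel_err k \<omega>)"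
  using a_pos T_pos expectation_QV[of "2 ^ k", unfolded two_power_powr]
  by (simp add: rel_err_def distrib_left)

text \<open>The quotient of \<open>rel_err\<close> and \<open>err_rate\<close> has second moment of
  order 2^(-2 \<epsilon> k), a summable geometric sequence.\<close>

lemma AE_rel_err_smallo:
  assumes "H < 3/4" "\<epsilon> > 0"
  shows "AE \<omega> in M. (\<lambda>k. rel_err k \<omega>) \<in> o(err_rate H \<epsilon>)"
proof -
  obtain C where C: "\<And>n. n > 0 \<Longrightarrow> variance (QV n) \<le> C * (real n powr (1 - 4 * H) + real n powr (-1))"
    and int: "\<And>n. n > 0 \<Longrightarrow> integrable M (\<lambda>\<omega>. (QV n \<omega> - expectation (QV n))\<^sup>2)"
    using variance_QV_le[OF assms(1)] by blast
  \<comment> \<open>The bound at n = 1 yields a nonnegative \<open>C\<close>, which is used below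
    when a denominator is replaced by a smaller one.\<close>
  have "0 \<le> variance (QV 1)" by simp
  also have "\<dots> \<le> C * 2" using C[of 1] by simp
  finally have "C \<ge> 0" by simp
  define A where "A = a\<^sup>2 * T powr (2 * H)"
  have "A > 0" using a_pos T_pos by (simp add: A_def)
  define w where "w k = A * 2 powr (real k * (1 - 2 * H)) * err_rate H \<epsilon> k" for k
  have w: "w k > 0" for k using \<open>A > 0\<close> err_rate_pos by (simp add: w_def)
  define Z where "Z k \<omega> = (QV (2 ^ k) \<omega> - expectation (QV (2 ^ k))) / w k" for k \<omega>
  have Z: "Z k \<omega> = rel_err k \<omega> / err_rate H \<epsilon> k" for k \<omega>
    by (simp add: Z_def rel_err_def w_def A_def)
  have "AE \<omega> in M. (\<lambda>k. Z k \<omega>) \<longlonglongrightarrow> 0"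
  proof (rule AE_tendsto_zero_if_summable_second_moment)
    show "random_variable borel (Z k)" for k
      unfolding Z_def[abs_def] using measurable_quadratic_variation by measurable
    show "integrable M (\<lambda>\<omega>. (Z k \<omega>)\<^sup>2)" for k
      unfolding Z_def power_divide using int by simp
    show "expectation (\<lambda>\<omega>. (Z k \<omega>)\<^sup>2) \<le> C / A\<^sup>2 * (2 powr (- 2 * \<epsilon>)) ^ k" for k
    proof -
      let ?s = "2 powr (real k * (1 - 4 * H)) + 2 powr (real k * (-1))"
      let ?u = "2 powr (real k * (1 - 2 * H) + real k * (-1/2 + \<epsilon>))"
      let ?v = "2 powr (real k * (1 - 2 * H) + real k * (2 * H - 3/2 + \<epsilon>))"
      \<comment> \<open>\<open>?u\<close> and \<open>?v\<close> are the two summands of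
        \<open>w k / A\<close>. Their squares match the two summands of the variance bound up to the
        common factor 2^(2 \<epsilon> k).\<close>
      have "2 powr (real k * (2 * \<epsilon>)) * ?s = ?u\<^sup>2 + ?v\<^sup>2"
        by (simp add: power2_eq_square distrib_left flip: powr_add) (simp add: algebra_simps)
      also have "\<dots> \<le> (?u + ?v)\<^sup>2" by (simp add: power2_sum)
      also have "?u + ?v = w k / A" using \<open>A > 0\<close> by (simp add: w_def err_rate_def powr_add distrib_left add_divide_distrib)
      finally have s: "2 powr (real k * (2 * \<epsilon>)) * ?s * A\<^sup>2 \<le> (w k)\<^sup>2"
        using \<open>A > 0\<close> by (simp add: power_divide field_simps)
      have "expectation (\<lambda>\<omega>. (Z k \<omega>)\<^sup>2) = variance (QV (2 ^ k)) / (w k)\<^sup>2"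
        unfolding Z_def power_divide by simp
      also have "\<dots> \<le> C * ?s / (w k)\<^sup>2"
        using C[of "2 ^ k", unfolded two_power_powr] by (intro divide_right_mono) auto
      also have "\<dots> \<le> C * ?s / (2 powr (real k * (2 * \<epsilon>)) * ?s * A\<^sup>2)"
        using s \<open>C \<ge> 0\<close> \<open>A > 0\<close> w[of k]
        by (intro divide_left_mono mult_nonneg_nonneg mult_pos_pos add_pos_pos) auto
      also have "\<dots> = C / (2 powr (real k * (2 * \<epsilon>)) * A\<^sup>2)"
      proof -
        have "?s > 0" by (intro add_pos_pos) auto
        then show ?thesis by simp
      qed
      also have "\<dots> = C / A\<^sup>2 * (2 powr (- 2 * \<epsilon>)) ^ k"
        by (simp add: powr_minus_divide power_divide powr_powr mult_ac flip: powr_realpow)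
      finally show ?thesis .
    qed
    have "2 powr (- 2 * \<epsilon>) < (1 :: real)" using assms by (simp add: powr_less_one)
    then show "summable (\<lambda>k. C / A\<^sup>2 * (2 powr (- 2 * \<epsilon>)) ^ k)"
      by (intro summable_mult summable_geometric) auto
  qed
  then show ?thesis
  proof eventually_elim
    case (elim \<omega>)
    then show ?case
      unfolding Z using err_rate_pos[of H \<epsilon>] by (intro smalloI_tendsto) (auto simp: less_imp_neq[symmetric])
  qed
qed

text \<open>For large \<open>\<epsilon>\<close> the rate may fail to tend to 0. Convergence is
  therefore taken from a smaller exponent, and the stated rate follows by monotonicity.\<close>

lemma AE_rel_err:
  assumes "H < 3/4" "\<epsilon> > 0"
  shows "AE \<omega> in M. (\<lambda>k. rel_err k \<omega>) \<longlonglongrightarrow> 0 \<and> (\<lambda>k. rel_err k \<omega>) \<in> o(err_rate H \<epsilon>)"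
proof -
  \<comment> \<open>The bound 3/4 - H is positive and half of 3/2 - 2H, so both conditions of
    \<open>err_rate_tendsto_0\<close> hold strictly.\<close>
  define \<epsilon>' where "\<epsilon>' = min \<epsilon> (min (1/4) (3/4 - H))"
  have e: "\<epsilon>' > 0" "\<epsilon>' \<le> \<epsilon>" "\<epsilon>' < 1/2" "\<epsilon>' < 3/2 - 2 * H" using assms by (auto simp: \<epsilon>'_def min_def)
  have "err_rate H \<epsilon>' \<in> O(\<lambda>_. 1)"
    using err_rate_tendsto_0[OF e(3,4)] by (intro bigoI_tendsto[of _ _ 0]) auto
  from AE_rel_err_smallo[OF assms(1) e(1)] show ?thesis
  proof eventually_elim
    case (elim \<omega>)
    from landau_o.small_big_trans[OF elim \<open>err_rate H \<epsilon>' \<in> O(\<lambda>_. 1)\<close>]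
    have "(\<lambda>k. rel_err k \<omega>) \<longlonglongrightarrow> 0" using smalloD_tendsto by force
    with landau_o.small_big_trans[OF elim err_rate_bigo_mono[OF e(2)]] show ?case by simp
  qed
qed

section \<open>Expansions of the three estimators\<close>

lemma AE_hurst_est_a:
  assumes "H < 1/2" "\<epsilon> > 0"
  shows "AE \<omega> in M. (\<lambda>k. hurst_est_a T a (mixed_process a b B W) k \<omega>) \<longlonglongrightarrow> H \<and>
    (\<exists>r1 r2. r1 \<in> O(\<lambda>k. 2 powr (real k * (2 * H - 1))) \<and> r2 \<in> o(\<lambda>k. 2 powr (real k * (-1/2 + \<epsilon>))) \<and>
      (\<forall>k. hurst_est_a T a (mixed_process a b B W) k \<omega> = H + r1 k + r2 k))"
proof -
  have "H < 3/4" using assms by simp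
  define A where "A = a\<^sup>2 * T powr (2 * H)"
  have "A > 0" using a_pos T_pos by (simp add: A_def)
  \<comment> \<open>The bias: b^2 T relative to the fractional part of the mean. It tends to 0
    because H < 1/2.\<close>
  define u where "u k = b\<^sup>2 * T / A * 2 powr (real k * (2 * H - 1))" for k
  have u_pos: "u k > 0" for k using \<open>A > 0\<close> b_pos T_pos by (simp add: u_def)
  have u_0: "u \<longlonglongrightarrow> 0"
    unfolding u_def[abs_def] using assms by (intro tendsto_mult_right_zero two_powr_tendsto_0) auto
  \<comment> \<open>For H < 1/2 the exponent 2H - 3/2 lies below -1/2, so the first summand of the
    rate dominates.\<close>
  have rate: "err_rate H \<epsilon> \<in> O(\<lambda>k. 2 powr (real k * (-1/2 + \<epsilon>)))"
  proof (rule bigoI[where c = 2])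
    have "2 powr (real k * (2 * H - 3/2 + \<epsilon>)) \<le> 2 powr (real k * (-1/2 + \<epsilon>))" for k
      using assms by (intro powr_mono mult_left_mono) auto
    then show "\<forall>\<^sub>F k in sequentially. norm (err_rate H \<epsilon> k) \<le> 2 * norm (2 powr (real k * (-1/2 + \<epsilon>)))"
      by (auto simp: err_rate_def)
  qed
  show ?thesis
    using AE_rel_err[OF \<open>H < 3/4\<close> assms(2)]
  proof eventually_elim
    case (elim \<omega>)
    define d where "d k = rel_err k \<omega> + u k" for k
    have d: "d \<longlonglongrightarrow> 0" unfolding d_def[abs_def] using elim u_0 by (auto intro: tendsto_add_zero)
    define r where "r k = hurst_est_a T a (mixed_process a b B W) k \<omega> - H" for k
    have QV: "QV (2 ^ k) \<omega> = a\<^sup>2 * T powr (2 * H) * 2 powr (real k * (1 - 2 * H)) * (1 + d k)" for k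
    proof -
      have "A * 2 powr (real k * (1 - 2 * H)) * u k = b\<^sup>2 * T * (2 powr (real k * (1 - 2 * H)) * 2 powr (real k * (2 * H - 1)))"
        using \<open>A > 0\<close> by (simp add: u_def)
      also have "2 powr (real k * (1 - 2 * H)) * 2 powr (real k * (2 * H - 1)) = (1 :: real)"
        by (simp add: algebra_simps flip: powr_add)
      finally show ?thesis
        using QV_eq[of k \<omega>] unfolding d_def A_def by (simp add: distrib_left)
    qed
    have r_d: "r \<in> O(d)"
      using log_estimator_error(1)[OF T_pos a_pos d QV] unfolding r_def[abs_def] hurst_est_a_def .
    \<comment> \<open>The absolute value keeps the sum with \<open>u\<close> positive, as
      \<open>bigo_add_split\<close> requires.\<close>
    have "d \<in> O(\<lambda>k. u k + \<bar>rel_err k \<omega>\<bar>)"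
      using u_pos by (intro bigoI[where c = 1]) (auto simp: d_def less_imp_le intro!: always_eventually
        order.trans[OF abs_triangle_ineq])
    with r_d have "r \<in> O(\<lambda>k. u k + \<bar>rel_err k \<omega>\<bar>)" by (rule landau_o.big_trans)
    then obtain r1 r2 where r12: "r1 \<in> O(u)" "r2 \<in> O(\<lambda>k. \<bar>rel_err k \<omega>\<bar>)" "\<And>k. r k = r1 k + r2 k"
      using u_pos by (rule_tac bigo_add_split[of r u "\<lambda>k. \<bar>rel_err k \<omega>\<bar>"]) (auto intro: add_pos_nonneg)
    have "r1 \<in> O(\<lambda>k. 2 powr (real k * (2 * H - 1)))"
      using r12(1) \<open>A > 0\<close> b_pos T_pos unfolding u_def[abs_def] by simp
    moreover have "r2 \<in> o(\<lambda>k. 2 powr (real k * (-1/2 + \<epsilon>)))"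
      using landau_o.big_small_trans[of r2 _ "\<lambda>k. rel_err k \<omega>" "err_rate H \<epsilon>"] r12(2) elim
        landau_o.small_big_trans[OF _ rate, of r2] by simp
    moreover have "\<forall>k. hurst_est_a T a (mixed_process a b B W) k \<omega> = H + r1 k + r2 k"
      using r12(3) by (simp add: r_def algebra_simps)
    moreover have "r \<longlonglongrightarrow> 0"
      using bigo_tendsto_0[OF r_d d] .
    then have "(\<lambda>k. hurst_est_a T a (mixed_process a b B W) k \<omega>) \<longlonglongrightarrow> H"
      unfolding r_def[abs_def] by (simp add: LIM_zero_iff)
    ultimately show ?case by blast
  qed
qed

text \<open>Since 1 + \<open>rel_err\<close> is eventually positive, \<open>log2_plus\<close>
  eventually agrees with the logarithm and \<open>log_estimator_error\<close> applies with d =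
  \<open>rel_err\<close>.\<close>

lemma AE_hurst_est_ab:
  assumes "H < 3/4" "\<epsilon> > 0"
  shows "AE \<omega> in M. (\<lambda>k. hurst_est_ab T a b (mixed_process a b B W) k \<omega>) \<longlonglongrightarrow> H \<and>
    (\<lambda>k. hurst_est_ab T a b (mixed_process a b B W) k \<omega> - H) \<in> o(err_rate H \<epsilon>)"
  using AE_rel_err[OF assms]
proof eventually_elim
  case (elim \<omega>)
  let ?r = "\<lambda>k. hurst_est_ab T a b (mixed_process a b B W) k \<omega> - H"
  note log = log_estimator_error[OF T_pos a_pos conjunct1[OF elim] QV_eq]
  have "?r \<in> O(\<lambda>k. rel_err k \<omega>)"
  proof (rule landau_o.big.in_cong[THEN iffD1, OF _ log(1)])
    show "\<forall>\<^sub>F k in sequentially. (real k + 2 * log 2 a - log 2 (QV (2 ^ k) \<omega> - b\<^sup>2 * T)) /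
        (2 * (real k - log 2 T)) - H = ?r k"
      using log(2) by eventually_elim (simp add: hurst_est_ab_def log2_plus_def)
  qed
  then have "?r \<longlonglongrightarrow> 0" "?r \<in> o(err_rate H \<epsilon>)"
    using elim by (auto intro: bigo_tendsto_0 landau_o.big_small_trans)
  then show ?case by (simp add: LIM_zero_iff)
qed

text \<open>In the ratio of consecutive levels the constant a^2 T^(2H) cancels and the powers leave
  2^(2H-1). Hence the error is half the difference of the logarithms of 1 + \<open>rel_err\<close>
  at the two levels.\<close>

lemma AE_hurst_est_b:
  assumes "H < 3/4" "\<epsilon> > 0"
  shows "AE \<omega> in M. (\<lambda>k. hurst_est_b T b (mixed_process a b B W) k \<omega>) \<longlonglongrightarrow> H \<and>
    (\<lambda>k. hurst_est_b T b (mixed_process a b B W) k \<omega> - H) \<in> o(err_rate H \<epsilon>)"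
  using AE_rel_err[OF assms]
proof eventually_elim
  case (elim \<omega>)
  let ?r = "\<lambda>k. hurst_est_b T b (mixed_process a b B W) k \<omega> - H"
  let ?L = "\<lambda>k. log 2 (1 + rel_err k \<omega>)"
  have pos: "\<forall>\<^sub>F k in sequentially. 1 + rel_err k \<omega> > 0"
    using order_tendstoD(1)[OF conjunct1[OF elim], of "-1"] by (simp add: eventually_mono)
  have eq: "\<forall>\<^sub>F k in sequentially. (?L k - ?L (Suc k)) / 2 = ?r k"
    \<comment> \<open>Positivity at both k and k + 1 makes the ratio positive, so that
      \<open>log2_plus\<close> is the logarithm and it splits.\<close>
    using pos eventually_compose_filterlim[OF pos filterlim_Suc]
  proof eventually_elim
    case (elim k)
    let ?p = "\<lambda>k. 2 powr (real k * (1 - 2 * H))"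
    have A: "a\<^sup>2 * T powr (2 * H) > 0" using a_pos T_pos by simp
    define q where "q = (QV (2 ^ k) \<omega> - b\<^sup>2 * T) / (QV (2 ^ Suc k) \<omega> - b\<^sup>2 * T)"
    have "q = ?p k / ?p (Suc k) * ((1 + rel_err k \<omega>) / (1 + rel_err (Suc k) \<omega>))"
      unfolding q_def QV_eq using A a_pos T_pos by simp
    also have "?p k / ?p (Suc k) = 2 powr (2 * H - 1)"
      by (simp add: algebra_simps flip: powr_diff)
    finally have q: "q = 2 powr (2 * H - 1) * ((1 + rel_err k \<omega>) / (1 + rel_err (Suc k) \<omega>))" .
    then have "q > 0" using elim by simp
    moreover have "log 2 q = 2 * H - 1 + (?L k - ?L (Suc k))"
      unfolding q using elim by (simp add: log_mult log_divide)
    moreover have "hurst_est_b T b (mixed_process a b B W) k \<omega> = 1/2 * (log2_plus q + 1)"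
      by (simp add: hurst_est_b_def q_def)
    ultimately show ?case
      by (simp add: log2_plus_def field_simps)
  qed
  have L: "?L \<in> O(\<lambda>k. rel_err k \<omega>)" using elim by (intro log2_one_plus_bigo) auto
  have small: "?L \<in> o(err_rate H \<epsilon>)" using L elim by (blast intro: landau_o.big_small_trans)
  \<comment> \<open>The shifted logarithm is first compared with the shifted rate, which
    \<open>err_rate_Suc\<close> brings back to level k.\<close>
  from landau_o.small.compose[OF this filterlim_Suc]
  have "(\<lambda>k. ?L (Suc k)) \<in> o(\<lambda>k. err_rate H \<epsilon> (Suc k))" .
  from landau_o.small_big_trans[OF this err_rate_Suc]
  have "(\<lambda>k. (?L k - ?L (Suc k)) / 2) \<in> o(err_rate H \<epsilon>)"
    using small by (auto intro: sum_in_smallo)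
  then have r: "?r \<in> o(err_rate H \<epsilon>)"
    by (rule landau_o.small.in_cong[THEN iffD1, OF eq])
  have "?L \<longlonglongrightarrow> 0" using L elim by (blast intro: bigo_tendsto_0)
  then have "(\<lambda>k. (?L k - ?L (Suc k)) / 2) \<longlonglongrightarrow> (0 - 0) / 2"
    by (intro tendsto_intros LIMSEQ_Suc) auto
  from Lim_transform_eventually[OF this eq] have "?r \<longlonglongrightarrow> 0" by simp
  with r show ?case by (simp add: LIM_zero_iff)
qed

lemma measurable_estimators:
  "random_variable borel (hurst_est_a T a (mixed_process a b B W) k)"
  "random_variable borel (hurst_est_b T b (mixed_process a b B W) k)"
  "random_variable borel (hurst_est_ab T a b (mixed_process a b B W) k)"
proof -
  note [measurable] = measurable_quadratic_variation
  have [measurable]: "log2_plus \<in> borel_measurable borel"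
    unfolding log2_plus_def[abs_def] by measurable
  show "random_variable borel (hurst_est_a T a (mixed_process a b B W) k)"
    unfolding hurst_est_a_def[abs_def] by measurable
  show "random_variable borel (hurst_est_b T b (mixed_process a b B W) k)"
    unfolding hurst_est_b_def[abs_def] by measurable
  show "random_variable borel (hurst_est_ab T a b (mixed_process a b B W) k)"
    unfolding hurst_est_ab_def[abs_def] by measurable
qed

end

theorem theorem3p6:
  fixes M :: "'a measure" and B W :: "real \<Rightarrow> 'a \<Rightarrow> real" and T a b H :: real
  assumes "prob_space M"
    and "T > 0" and "a > 0" and "b > 0" and "0 < H" and "H < 1"
    and "fractional_brownian_motion M {0..T} H B"
    and "wiener_process M {0..T} W"
    and "indep_processes M {0..T} B W"
  defines "X \<equiv> mixed_process a b B W"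
  shows
    "(H < 1/2 \<longrightarrow>
        strongly_consistent M (hurst_est_a T a X) H \<and>
        (\<forall>\<epsilon>>0. AE \<omega> in M. \<exists>r1 r2 :: nat \<Rightarrow> real.
           r1 \<in> O(\<lambda>k. 2 powr (real k * (2 * H - 1))) \<and>
           r2 \<in> o(\<lambda>k. 2 powr (real k * (-1/2 + \<epsilon>))) \<and>
           (\<forall>k. real k > log 2 T \<longrightarrow> hurst_est_a T a X k \<omega> = H + r1 k + r2 k))) \<and>
     (H < 3/4 \<longrightarrow>
        consistent M (hurst_est_b T b X) H \<and>
        (\<forall>\<epsilon>>0. AE \<omega> in M. \<exists>r1 r2 :: nat \<Rightarrow> real.
           r1 \<in> o(\<lambda>k. 2 powr (real k * (-1/2 + \<epsilon>))) \<and>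
           r2 \<in> o(\<lambda>k. 2 powr (real k * (2 * H - 3/2 + \<epsilon>))) \<and>
           (\<forall>k. real k > log 2 T \<longrightarrow> hurst_est_b T b X k \<omega> = H + r1 k + r2 k))) \<and>
     (H < 3/4 \<longrightarrow>
        strongly_consistent M (hurst_est_ab T a b X) H \<and>
        (\<forall>\<epsilon>>0. AE \<omega> in M. \<exists>r1 r2 :: nat \<Rightarrow> real.
           r1 \<in> o(\<lambda>k. 2 powr (real k * (-1/2 + \<epsilon>))) \<and>
           r2 \<in> o(\<lambda>k. 2 powr (real k * (2 * H - 3/2 + \<epsilon>))) \<and>
           (\<forall>k. real k > log 2 T \<longrightarrow> hurst_est_ab T a b X k \<omega> = H + r1 k + r2 k)))"
proof -
  interpret prob_space M by fact
  interpret mixed_fbm M B W T a b H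
    by unfold_locales (fact assms)+
  \<comment> \<open>This acts on one path at a time, so the two remainders may depend on the
    path.\<close>
  have split: "\<exists>r1 r2 :: nat \<Rightarrow> real. r1 \<in> o(\<lambda>k. 2 powr (real k * (-1/2 + \<epsilon>))) \<and>
      r2 \<in> o(\<lambda>k. 2 powr (real k * (2 * H - 3/2 + \<epsilon>))) \<and>
      (\<forall>k. real k > log 2 T \<longrightarrow> est k \<omega> = H + r1 k + r2 k)"
    if "(\<lambda>k. est k \<omega> - H) \<in> o(err_rate H \<epsilon>)" for est :: "nat \<Rightarrow> 'a \<Rightarrow> real" and \<omega> \<epsilon>
  proof -
    from err_rate_split[OF that] obtain r1 r2 where "r1 \<in> o(\<lambda>k. 2 powr (real k * (-1/2 + \<epsilon>)))"
      "r2 \<in> o(\<lambda>k. 2 powr (real k * (2 * H - 3/2 + \<epsilon>)))" "\<And>k. est k \<omega> - H = r1 k + r2 k"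
      by blast
    then show ?thesis by (intro exI[of _ r1] exI[of _ r2]) (simp add: algebra_simps)
  qed
  have a: "strongly_consistent M (hurst_est_a T a X) H \<and>
      (\<forall>\<epsilon>>0. AE \<omega> in M. \<exists>r1 r2 :: nat \<Rightarrow> real.
         r1 \<in> O(\<lambda>k. 2 powr (real k * (2 * H - 1))) \<and>
         r2 \<in> o(\<lambda>k. 2 powr (real k * (-1/2 + \<epsilon>))) \<and>
         (\<forall>k. real k > log 2 T \<longrightarrow> hurst_est_a T a X k \<omega> = H + r1 k + r2 k))" if "H < 1/2"
  proof (intro conjI allI impI)
    \<comment> \<open>The limit does not involve \<open>\<epsilon>\<close>, so the expansion lemma
      is used at the value 1.\<close>
    show "strongly_consistent M (hurst_est_a T a X) H"
      using AE_hurst_est_a[OF that zero_less_one] measurable_estimators(1)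
      unfolding strongly_consistent_def X_def by (auto elim: eventually_mono)
  next
    fix \<epsilon> :: real
    assume "\<epsilon> > 0"
    from AE_hurst_est_a[OF that this]
    show "AE \<omega> in M. \<exists>r1 r2 :: nat \<Rightarrow> real.
         r1 \<in> O(\<lambda>k. 2 powr (real k * (2 * H - 1))) \<and>
         r2 \<in> o(\<lambda>k. 2 powr (real k * (-1/2 + \<epsilon>))) \<and>
         (\<forall>k. real k > log 2 T \<longrightarrow> hurst_est_a T a X k \<omega> = H + r1 k + r2 k)"
      unfolding X_def by (rule eventually_mono) blast
  qed
  \<comment> \<open>Almost sure convergence is shown here; convergence in probability is derived
    from it below.\<close>
  have b: "strongly_consistent M (hurst_est_b T b X) H" and
    b': "\<forall>\<epsilon>>0. AE \<omega> in M. (\<lambda>k. hurst_est_b T b X k \<omega> - H) \<in> o(err_rate H \<epsilon>)" if "H < 3/4"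
    using AE_hurst_est_b[OF that] AE_hurst_est_b[OF that zero_less_one] measurable_estimators(2)
    unfolding strongly_consistent_def X_def by (auto elim: eventually_mono)
  have ab: "strongly_consistent M (hurst_est_ab T a b X) H" and
    ab': "\<forall>\<epsilon>>0. AE \<omega> in M. (\<lambda>k. hurst_est_ab T a b X k \<omega> - H) \<in> o(err_rate H \<epsilon>)" if "H < 3/4"
    using AE_hurst_est_ab[OF that] AE_hurst_est_ab[OF that zero_less_one] measurable_estimators(3)
    unfolding strongly_consistent_def X_def by (auto elim: eventually_mono)
  show ?thesis
  proof (intro conjI impI a, assumption)
    assume H: "H < 3/4"
    show "consistent M (hurst_est_b T b X) H"
      using consistent_if_strongly_consistent[OF assms(1) b[OF H]] .
    show "strongly_consistent M (hurst_est_ab T a b X) H" using ab[OF H] .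
    show "\<forall>\<epsilon>>0. AE \<omega> in M. \<exists>r1 r2 :: nat \<Rightarrow> real.
           r1 \<in> o(\<lambda>k. 2 powr (real k * (-1/2 + \<epsilon>))) \<and>
           r2 \<in> o(\<lambda>k. 2 powr (real k * (2 * H - 3/2 + \<epsilon>))) \<and>
           (\<forall>k. real k > log 2 T \<longrightarrow> hurst_est_b T b X k \<omega> = H + r1 k + r2 k)"
      by (intro allI impI, rule eventually_mono[OF b'[OF H, rule_format]], assumption, rule split)
    show "\<forall>\<epsilon>>0. AE \<omega> in M. \<exists>r1 r2 :: nat \<Rightarrow> real.
           r1 \<in> o(\<lambda>k. 2 powr (real k * (-1/2 + \<epsilon>))) \<and>
           r2 \<in> o(\<lambda>k. 2 powr (real k * (2 * H - 3/2 + \<epsilon>))) \<and>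
           (\<forall>k. real k > log 2 T \<longrightarrow> hurst_est_ab T a b X k \<omega> = H + r1 k + r2 k)"
      by (intro allI impI, rule eventually_mono[OF ab'[OF H, rule_format]], assumption, rule split)
  qed
qed

end
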